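(* Assume $a,b\in C^1(\mathbb{R})$ are globally Lipschitz continuous and $a\ge a_0>0$. Let $u\in K$ satisfy $F(u)=\min_K F$. Then $u\in W^{2,\infty}(0,T)$ and there exists a nonnegative Radon measure $f$ on $[0,T-1]$ with $\operatorname{supp} f\subset\omega_c$ such that $$-2a(u(x))u''(x)-a'(u(x))\,u'(x)^2+b'(u(x))=\int_{x-1}^x f \quad\text{for a.e. } x\in(0,T).$$
   Context: Fix $T>1$. $X=H^1_0(0,T)$, $U=\{1+v:v\in X\}$, $F(u)=\int_0^T[a(u)(u')^2+b(u)]\,dx$, $(Bu)(x)=\int_x^{x+1}u$ for $x\in[0,T-1]$, $K=\{u\in U: Bu\ge0 \text{ on }[0,T-1]\}$. The contact set of $u\in K$ is $\omega_c=\{x\in[0,T-1]: (Bu)(x)=0\}$. A Radon measure $f$ on $[0,T-1]$ is extended by zero outside $[0,T-1]$, and $\int_{x-1}^x f$ denotes $f([x-1,x])$. *)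

theory Defs
  imports "HOL-Analysis.Analysis"
begin

text \<open>Functions on [0,T] are represented by functions real => real; only their
values on [0,T] matter.  g is a weak derivative of u on (0,T), where u is taken
in its (absolutely) continuous representative: g is integrable on [0,T] and
u x = u 0 + integral of g over [0,x] for all x in [0,T].\<close>
definition weak_deriv_on :: "real \<Rightarrow> (real \<Rightarrow> real) \<Rightarrow> (real \<Rightarrow> real) \<Rightarrow> bool" where
  "weak_deriv_on T u g \<longleftrightarrow> g \<in> borel_measurable lborel \<and> set_integrable lborel {0..T} g \<and>
     (\<forall>x\<in>{0..T}. u x = u 0 + (LBINT t:{0..x}. g t))"

definition H1 :: "real \<Rightarrow> (real \<Rightarrow> real) \<Rightarrow> bool" where
  "H1 T u \<longleftrightarrow> (\<exists>g. weak_deriv_on T u g \<and> set_integrable lborel {0..T} (\<lambda>x. (g x)\<^sup>2))"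

definition H10 :: "real \<Rightarrow> (real \<Rightarrow> real) \<Rightarrow> bool" where
  "H10 T v \<longleftrightarrow> H1 T v \<and> v 0 = 0 \<and> v T = 0"

definition Uset :: "real \<Rightarrow> (real \<Rightarrow> real) set" where
  "Uset T = {u. H10 T (\<lambda>x. u x - 1)}"

text \<open>The (a.e. unique) weak derivative u'.\<close>
definition wderiv :: "real \<Rightarrow> (real \<Rightarrow> real) \<Rightarrow> (real \<Rightarrow> real)" where
  "wderiv T u = (SOME g. weak_deriv_on T u g)"

definition Ffun :: "(real \<Rightarrow> real) \<Rightarrow> (real \<Rightarrow> real) \<Rightarrow> real \<Rightarrow> (real \<Rightarrow> real) \<Rightarrow> real" where
  "Ffun a b T u = (LBINT x:{0..T}. a (u x) * (wderiv T u x)\<^sup>2 + b (u x))"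

definition Bop :: "(real \<Rightarrow> real) \<Rightarrow> real \<Rightarrow> real" where
  "Bop u x = (LBINT t:{x..x+1}. u t)"

definition Kset :: "real \<Rightarrow> (real \<Rightarrow> real) set" where
  "Kset T = {u \<in> Uset T. \<forall>x\<in>{0..T-1}. Bop u x \<ge> 0}"

definition contact_set :: "real \<Rightarrow> (real \<Rightarrow> real) \<Rightarrow> real set" where
  "contact_set T u = {x \<in> {0..T-1}. Bop u x = 0}"

definition msupp :: "real measure \<Rightarrow> real set" where
  "msupp f = {x. \<forall>e>0. emeasure f (ball x e) > 0}"

definition ess_bdd_on :: "real \<Rightarrow> (real \<Rightarrow> real) \<Rightarrow> bool" where
  "ess_bdd_on T g \<longleftrightarrow> (\<exists>M. AE x in lborel. x \<in> {0<..<T} \<longrightarrow> \<bar>g x\<bar> \<le> M)"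

end

(* Write v for a test function in H^1_0(0,T), v' for its weak derivative, and S for the contact set.
   If Bv > 0 on S, then u + hv stays in K for small h > 0, so F'(u)v >= 0; adding a small multiple of
   x(T - x), whose image under B is bounded below by 1/6, this extends to Bv >= 0 on S. Hence
   Bv |-> F'(u)v is a well-defined positive functional on a space of functions on S that contains a
   function bounded below by 1, and M. Riesz's extension theorem (Zorn) extends it to a positive functional L on
   all bounded functions on S. No representation theorem is needed: with Phi(s) = L(1_(-oo,s]),
   summation by parts gives L(Bv) = int v(t) (Phi(t) - Phi(t-1)) dt, and Phi is nondecreasing and
   constant off S, so it is the distribution function of the measure f.
   The du Bois-Reymond lemma then shows that 2a(u)u' has the bounded density
   a'(u)u'^2 + b'(u) - (Phi(t) - Phi(t-1)). This makes u' Lipschitz and differentiable where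
   Phi(t) and Phi(t-1) are continuous, i.e. off a countable set. *)

theory Submission
  imports Defs
begin

text \<open>Extending to all bounded functions on the contact set, not just to continuous ones, is
  what makes indicators of half-lines admissible arguments. The price is that the extension is only
  finitely additive, so \<open>\<Phi>\<close> need not be right-continuous. This is harmless:
  \<open>\<Phi>\<close> enters the weak equation only under integrals, and the right-continuous
  regularization that defines the measure differs from it at most at countably many points. The
  direction x(T - x) acts as a constraint qualification: it strictly increases Bu on all of [0,T-1],
  endpoints included, so directions with Bv >= 0 on the contact set are limits of strictly feasible
  ones. The same function is the order unit that Riesz's theorem requires. Regularity is a
  bootstrap. At the outset u' is only square integrable, so the density of 2a(u)u' is merely
  integrable. That already makes 2a(u)u', and by a(u) >= a0 > 0 also u', continuous and thus bounded
  on [0,T]; only with this knowledge is the density bounded.\<close>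

lemma continuous_on_Icc_bounded:
  fixes f :: "real \<Rightarrow> real"
  assumes "continuous_on {c..d} f"
  obtains B where "\<And>x. x \<in> {c..d} \<Longrightarrow> \<bar>f x\<bar> \<le> B"
  using compact_imp_bounded[OF compact_continuous_image[OF assms compact_Icc]]
  by (auto simp: bounded_iff simp del: atLeastAtMost_iff)

section \<open>Extension of positive functionals\<close>

text \<open>A partially defined functional is represented by its graph, so that Zorn's lemma applies to
set inclusion; single-valuedness is not required, as it follows from the positivity clause (applied to
the zero function).\<close>

definition pos_graph :: "'a set \<Rightarrow> (('a \<Rightarrow> real) \<times> real) set \<Rightarrow> bool" where
  "pos_graph S G \<longleftrightarrow>
     (\<forall>\<phi> r \<psi> s. (\<phi>, r) \<in> G \<longrightarrow> (\<psi>, s) \<in> G \<longrightarrow> ((\<lambda>x. \<phi> x + \<psi> x), r + s) \<in> G) \<and>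
     (\<forall>\<phi> r t. (\<phi>, r) \<in> G \<longrightarrow> ((\<lambda>x. t * \<phi> x), t * r) \<in> G) \<and>
     (\<forall>\<phi> r. (\<phi>, r) \<in> G \<longrightarrow> (\<forall>x\<in>S. 0 \<le> \<phi> x) \<longrightarrow> 0 \<le> r)"

lemma pos_graph_add: "pos_graph S G \<Longrightarrow> (\<phi>, r) \<in> G \<Longrightarrow> (\<psi>, s) \<in> G \<Longrightarrow> ((\<lambda>x. \<phi> x + \<psi> x), r + s) \<in> G"
  and pos_graph_scale: "pos_graph S G \<Longrightarrow> (\<phi>, r) \<in> G \<Longrightarrow> ((\<lambda>x. t * \<phi> x), t * r) \<in> G"
  and pos_graph_nonneg: "pos_graph S G \<Longrightarrow> (\<phi>, r) \<in> G \<Longrightarrow> (\<And>x. x \<in> S \<Longrightarrow> 0 \<le> \<phi> x) \<Longrightarrow> 0 \<le> r"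
  unfolding pos_graph_def by blast+

lemma pos_graph_mono:
  assumes G: "pos_graph S G" and "(\<phi>, r) \<in> G" "(\<psi>, s) \<in> G" and le: "\<And>x. x \<in> S \<Longrightarrow> \<phi> x \<le> \<psi> x"
  shows "r \<le> s"
proof -
  have "((\<lambda>x. \<psi> x + (-1) * \<phi> x), s + (-1) * r) \<in> G"
    using assms by (intro pos_graph_add[OF G] pos_graph_scale[OF G])
  from pos_graph_nonneg[OF G this] le show ?thesis by simp
qed

text \<open>One-dimensional step of the Riesz extension: any value between the values of the
  minorants and those of the majorants of \<open>\<phi>\<close> in the graph preserves positivity.
  The multiples of \<open>e\<close> by plus and minus \<open>\<bar>B\<bar>\<close> show that both
  kinds exist.\<close>

lemma pos_graph_extend:
  fixes S :: "'a set"
  assumes G: "pos_graph S G" and e: "(e, c) \<in> G" "\<And>x. x \<in> S \<Longrightarrow> 1 \<le> e x"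
    and B: "\<And>x. x \<in> S \<Longrightarrow> \<bar>\<phi> x\<bar> \<le> B"
  obtains r where "pos_graph S {((\<lambda>x. g x + t * \<phi> x), s + t * r) | g s t. (g, s) \<in> G}"
proof -
  define D where "D = {s. \<exists>g. (g, s) \<in> G \<and> (\<forall>x\<in>S. \<phi> x \<le> g x)}"
  \<comment> \<open>The infimum over the majorants is the largest admissible value.\<close>
  define r where "r = Inf D"
  have up: "\<bar>B\<bar> * c \<in> D"
    unfolding D_def using pos_graph_scale[OF G e(1), of "\<bar>B\<bar>"] mult_left_mono[OF e(2), of _ "\<bar>B\<bar>"] B
    by (fastforce intro!: exI[of _ "\<lambda>x. \<bar>B\<bar> * e x"])
  have low: "s \<le> d" if "(g, s) \<in> G" "\<And>x. x \<in> S \<Longrightarrow> g x \<le> \<phi> x" "d \<in> D" for g s d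
  proof -
    from \<open>d \<in> D\<close> obtain h where "(h, d) \<in> G" "\<forall>x\<in>S. \<phi> x \<le> h x" by (auto simp: D_def)
    then show ?thesis using pos_graph_mono[OF G that(1), of h d] that(2) by force
  qed
  have "((\<lambda>x. (- \<bar>B\<bar>) * e x), (- \<bar>B\<bar>) * c) \<in> G" by (rule pos_graph_scale[OF G e(1)])
  moreover have "(- \<bar>B\<bar>) * e x \<le> \<phi> x" if "x \<in> S" for x
    using mult_left_mono[OF e(2)[OF that], of "\<bar>B\<bar>"] B[OF that] abs_ge_zero[of "\<phi> x"] by simp
  ultimately have bdd: "bdd_below D"
    using low unfolding bdd_below_def by blast
  have r_le: "r \<le> s" if "(g, s) \<in> G" "\<And>x. x \<in> S \<Longrightarrow> \<phi> x \<le> g x" for g s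
    unfolding r_def by (rule cInf_lower[OF _ bdd]) (use that in \<open>auto simp: D_def\<close>)
  have le_r: "s \<le> r" if "(g, s) \<in> G" "\<And>x. x \<in> S \<Longrightarrow> g x \<le> \<phi> x" for g s
    unfolding r_def by (rule cInf_greatest) (use up low that in auto)
  let ?G = "{((\<lambda>x. g x + t * \<phi> x), s + t * r) | g s t. (g, s) \<in> G}"
  have mem: "(f, q) \<in> ?G" if "(g, s) \<in> G" "f = (\<lambda>x. g x + t * \<phi> x)" "q = s + t * r" for f q g s t
    unfolding that(2,3) using that(1) by blast
  have "pos_graph S ?G"
    unfolding pos_graph_def
  proof (intro conjI allI impI)
    fix f1 s1 f2 s2 assume "(f1, s1) \<in> ?G" "(f2, s2) \<in> ?G"
    then obtain g1 u1 t1 g2 u2 t2 where *: "(g1, u1) \<in> G" "(g2, u2) \<in> G"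
      "f1 = (\<lambda>x. g1 x + t1 * \<phi> x)" "s1 = u1 + t1 * r" "f2 = (\<lambda>x. g2 x + t2 * \<phi> x)" "s2 = u2 + t2 * r"
      by blast
    have "(\<lambda>x. f1 x + f2 x) = (\<lambda>x. (g1 x + g2 x) + (t1 + t2) * \<phi> x)" "s1 + s2 = (u1 + u2) + (t1 + t2) * r"
      by (auto simp: * algebra_simps)
    then show "((\<lambda>x. f1 x + f2 x), s1 + s2) \<in> ?G"
      by (rule mem[OF pos_graph_add[OF G *(1,2)]])
  next
    fix f s t assume "(f, s) \<in> ?G"
    then obtain g u t1 where *: "(g, u) \<in> G" "f = (\<lambda>x. g x + t1 * \<phi> x)" "s = u + t1 * r" by blast
    have "(\<lambda>x. t * f x) = (\<lambda>x. t * g x + (t * t1) * \<phi> x)" "t * s = t * u + (t * t1) * r"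
      by (auto simp: * algebra_simps)
    then show "((\<lambda>x. t * f x), t * s) \<in> ?G"
      by (rule mem[OF pos_graph_scale[OF G *(1)]])
  next
    fix f s assume "(f, s) \<in> ?G" and nn: "\<forall>x\<in>S. 0 \<le> f x"
    then obtain g u t where *: "(g, u) \<in> G" "f = (\<lambda>x. g x + t * \<phi> x)" "s = u + t * r" by blast
    \<comment> \<open>Nonnegativity of \<open>g + t * \<phi>\<close> on \<open>S\<close> says that
      \<open>- g / t\<close> is a minorant of \<open>\<phi>\<close> if \<open>t > 0\<close>, and a
      majorant if \<open>t < 0\<close>.\<close>
    consider "t = 0" | "t > 0" | "t < 0" by linarith
    then show "0 \<le> s"
    proof cases
      case 1
      then show ?thesis using pos_graph_nonneg[OF G *(1)] nn * by simp
    next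
      case 2
      have "(-1/t) * u \<le> r"
        by (rule le_r[OF pos_graph_scale[OF G *(1)]]) (use nn * 2 in \<open>auto simp: field_simps\<close>)
      then show ?thesis using 2 * by (simp add: field_simps)
    next
      case 3
      have "r \<le> (-1/t) * u"
        by (rule r_le[OF pos_graph_scale[OF G *(1)]]) (use nn * 3 in \<open>auto simp: field_simps\<close>)
      then show ?thesis using 3 * by (simp add: field_simps)
    qed
  qed
  then show thesis by (rule that)
qed

text \<open>A maximal graph already contains every function bounded on \<open>S\<close>, since
  adjoining one yields a positive graph that includes it. Adjoining also works for a function in the
  domain: positivity then forces the old value.\<close>

lemma positive_extension:
  fixes S :: "'a set"
  assumes V: "pos_graph S V" and e: "(e, c) \<in> V" "\<And>x. x \<in> S \<Longrightarrow> 1 \<le> e x"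
  obtains G where "V \<subseteq> G" "pos_graph S G" "\<forall>\<phi>. bounded (\<phi> ` S) \<longrightarrow> (\<exists>r. (\<phi>, r) \<in> G)"
proof -
  define A where "A = {G. V \<subseteq> G \<and> pos_graph S G}"
  have "\<exists>M\<in>A. \<forall>X\<in>A. M \<subseteq> X \<longrightarrow> X = M"
  proof (rule subset_Zorn_nonempty)
    show "A \<noteq> {}" using V by (auto simp: A_def)
  next
    fix C assume C: "C \<noteq> {}" "subset.chain A C"
    have CA: "C \<subseteq> A" and comp: "\<And>X Y. X \<in> C \<Longrightarrow> Y \<in> C \<Longrightarrow> X \<subseteq> Y \<or> Y \<subseteq> X"
      using C(2) by (auto simp: subset_chain_def)
    have CP: "pos_graph S X" if "X \<in> C" for X using CA that by (auto simp: A_def)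
    have "pos_graph S (\<Union>C)"
      unfolding pos_graph_def
    proof (intro conjI allI impI)
      fix f1 s1 f2 s2 assume "(f1, s1) \<in> \<Union>C" "(f2, s2) \<in> \<Union>C"
      then obtain X Y where "X \<in> C" "(f1, s1) \<in> X" "Y \<in> C" "(f2, s2) \<in> Y" by blast
      then obtain X where *: "X \<in> C" "(f1, s1) \<in> X" "(f2, s2) \<in> X"
        using comp[of X Y] by blast
      then show "((\<lambda>x. f1 x + f2 x), s1 + s2) \<in> \<Union>C"
        using pos_graph_add[OF CP[OF *(1)] *(2,3)] by blast
    next
      fix f s t assume "(f, s) \<in> \<Union>C"
      then obtain X where *: "X \<in> C" "(f, s) \<in> X" by blast
      then show "((\<lambda>x. t * f x), t * s) \<in> \<Union>C"
        using pos_graph_scale[OF CP[OF *(1)] *(2)] by blast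
    next
      fix f s assume "(f, s) \<in> \<Union>C" "\<forall>x\<in>S. 0 \<le> f x"
      then obtain X where *: "X \<in> C" "(f, s) \<in> X" by blast
      then show "0 \<le> s"
        using pos_graph_nonneg[OF CP[OF *(1)] *(2)] \<open>\<forall>x\<in>S. 0 \<le> f x\<close> by blast
    qed
    moreover have "V \<subseteq> \<Union>C" using C(1) CA by (fastforce simp: A_def)
    ultimately show "\<Union>C \<in> A" by (auto simp: A_def)
  qed
  then obtain M where M: "V \<subseteq> M" "pos_graph S M" and max: "\<And>X. X \<in> A \<Longrightarrow> M \<subseteq> X \<Longrightarrow> X = M"
    by (auto simp: A_def)
  have "\<exists>r. (\<phi>, r) \<in> M" if "bounded (\<phi> ` S)" for \<phi>
  proof -
    obtain B where B: "\<And>x. x \<in> S \<Longrightarrow> \<bar>\<phi> x\<bar> \<le> B" using \<open>bounded (\<phi> ` S)\<close> by (auto simp: bounded_iff)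
    have eM: "(e, c) \<in> M" using e M by auto
    obtain r where r: "pos_graph S {((\<lambda>x. g x + t * \<phi> x), s + t * r) | g s t. (g, s) \<in> M}" (is "pos_graph S ?G")
      using pos_graph_extend[OF M(2) eM, of \<phi> B] e(2) B by blast
    have "M \<subseteq> ?G"
    proof safe
      fix g s assume "(g, s) \<in> M"
      then show "\<exists>g' s' t. (g, s) = ((\<lambda>x. g' x + t * \<phi> x), s' + t * r) \<and> (g', s') \<in> M"
        by (intro exI[of _ g] exI[of _ s] exI[of _ 0]) auto
    qed
    moreover have "?G \<in> A" using r M(1) \<open>M \<subseteq> ?G\<close> by (auto simp: A_def)
    ultimately have eq: "?G = M" using max by blast
    have "((\<lambda>x. 0 * e x), 0 * c) \<in> M" by (rule pos_graph_scale[OF M(2) eM])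
    then have "(\<phi>, r) \<in> ?G"
      by (intro CollectI exI[of _ "\<lambda>x. 0 * e x"] exI[of _ "0 * c"] exI[of _ 1] conjI) auto
    then show ?thesis unfolding eq by blast
  qed
  with M that show thesis by blast
qed

section \<open>Representation of positive functionals on smooth functions\<close>

text \<open>The derivative is known only almost everywhere, because it will involve a monotone
  function that may jump. The Lipschitz bound dominates the difference quotients and so excludes a
  singular part.\<close>

lemma lipschitz_fundamental_theorem:
  fixes f f' :: "real \<Rightarrow> real"
  assumes ab: "a \<le> b" and lip: "L-lipschitz_on {a..b} f"
    and der: "AE x in lborel. x \<in> {a<..<b} \<longrightarrow> (f has_real_derivative f' x) (at x)"
    and meas [measurable]: "f' \<in> borel_measurable borel"
  shows "set_integrable lborel {a..b} f'" and "(LBINT x:{a..b}. f' x) = f b - f a"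
proof -
  \<comment> \<open>Clamping extends \<open>f\<close> to a Lipschitz function on the line, so that
    forward steps from points near \<open>b\<close> make sense. The antiderivative is taken on
    \<open>{a-1..b+2}\<close> to leave room for steps of size at most 1.\<close>
  define F where "F x = f (max a (min b x))" for x
  have F_eq: "F x = f x" if "x \<in> {a..b}" for x using that by (auto simp: F_def)
  have L0: "0 \<le> L" using lip lipschitz_on_nonneg by blast
  have F_lip: "\<bar>F x - F y\<bar> \<le> L * \<bar>x - y\<bar>" for x y
  proof -
    have "\<bar>F x - F y\<bar> \<le> L * \<bar>max a (min b x) - max a (min b y)\<bar>"
      using lipschitz_onD[OF lip, of "max a (min b x)" "max a (min b y)"] ab
      by (auto simp: F_def dist_real_def)
    also have "\<dots> \<le> L * \<bar>x - y\<bar>" by (intro mult_left_mono L0) auto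
    finally show ?thesis .
  qed
  have contF: "continuous_on UNIV F"
    by (rule lipschitz_on_continuous_on[of L]) (auto intro!: lipschitz_onI L0 simp: dist_real_def F_lip)
  have [measurable]: "F \<in> borel_measurable borel" by (rule borel_measurable_continuous_onI[OF contF])
  obtain G where G: "\<And>x. x \<in> {a-1..b+2} \<Longrightarrow> (G has_vector_derivative F x) (at x within {a-1..b+2})"
    using antiderivative_continuous[of "a-1" "b+2" F] continuous_on_subset[OF contF] by auto
  have G': "(G has_real_derivative F x) (at x)" if "x \<in> {a-1<..<b+2}" for x
    using G[of x] that at_within_interior[of x "{a-1..b+2}"]
    by (auto simp: has_real_derivative_iff_has_vector_derivative)
  define h where "h n = 1 / real (Suc n)" for n
  have h0: "h n > 0" "h n \<le> 1" for n by (auto simp: h_def)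
  have "h \<longlonglongrightarrow> 0" unfolding h_def by (rule LIMSEQ_Suc[OF lim_1_over_n])
  then have h_lim: "filterlim h (at 0) sequentially"
    using h0(1) by (auto simp: filterlim_at intro!: always_eventually) (metis less_irrefl)
  have quot: "(\<lambda>n. (k (x + h n) - k x) / h n) \<longlonglongrightarrow> d" if "(k has_real_derivative d) (at x)" for k d and x :: real
    using filterlim_compose[OF that[unfolded DERIV_def] h_lim] .
  \<comment> \<open>The difference quotients are bounded by the Lipschitz constant, and their integrals telescope
    in terms of an antiderivative of the clamped function; dominated convergence does the rest.\<close>
  define s where "s n x = indicator {a..b} x * ((F (x + h n) - F x) / h n)" for n x
  have int_s: "integrable lborel (s n)" "integral\<^sup>L lborel (s n) = (G (b + h n) - G b) / h n - (G (a + h n) - G a) / h n" for n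
  proof -
    have "((\<lambda>x. (G (x + h n) - G x) / h n) has_vector_derivative ((F (x + h n) - F x) / h n)) (at x within {a..b})" 
      if "x \<in> {a..b}" for x
    proof -
      have 1: "((\<lambda>x. G (x + h n)) has_real_derivative F (x + h n)) (at x)"
        using G'[of "x + h n"] that h0[of n] by (subst DERIV_shift[symmetric]) (auto simp: add.commute)
      have "((\<lambda>x. (G (x + h n) - G x) / h n) has_real_derivative ((F (x + h n) - F x) / h n)) (at x)"
        by (intro DERIV_cdivide DERIV_diff 1 G') (use that in auto)
      then show ?thesis
        using has_real_derivative_iff_has_vector_derivative has_vector_derivative_at_within by blast
    qed
    moreover have c: "continuous_on {a..b} (\<lambda>x. (F (x + h n) - F x) / h n)"
      by (intro continuous_intros continuous_on_compose2[OF contF]) (use h0[of n] in auto)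
    ultimately show "integral\<^sup>L lborel (s n) = (G (b + h n) - G b) / h n - (G (a + h n) - G a) / h n"
      using integral_FTC_atLeastAtMost[OF ab, of "\<lambda>x. (G (x + h n) - G x) / h n" "\<lambda>x. (F (x + h n) - F x) / h n"]
      by (simp add: s_def[abs_def])
    show "integrable lborel (s n)"
      using borel_integrable_atLeastAtMost'[OF c] by (simp add: s_def[abs_def] set_integrable_def)
  qed
  have lim1: "AE x in lborel. (\<lambda>n. s n x) \<longlonglongrightarrow> indicator {a..b} x * f' x"
  proof -
    have "AE x in lborel. x \<noteq> a" "AE x in lborel. x \<noteq> b" by (auto intro: AE_lborel_singleton)
    with der show ?thesis
    proof eventually_elim
      case (elim x)
      show ?case
      proof (cases "x \<in> {a<..<b}")
        case True
        have "eventually (\<lambda>y. y \<in> {a<..<b}) (nhds x)" using True by (intro eventually_nhds_in_open) auto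
        then have "eventually (\<lambda>y. F y = f y) (nhds x)" by eventually_elim (auto intro: F_eq)
        then have "(F has_real_derivative f' x) (at x)"
          using elim True by (subst DERIV_cong_ev[of x x F f]) auto
        from quot[OF this] True show ?thesis by (simp add: s_def)
      next
        case False
        then have "x \<notin> {a..b}" using elim by auto
        then show ?thesis by (simp add: s_def)
      qed
    qed
  qed
  have bd: "AE x in lborel. norm (s n x) \<le> indicator {a..b} x * L" for n
  proof (rule AE_I2)
    fix x
    have "\<bar>F (x + h n) - F x\<bar> / h n \<le> L"
      using F_lip[of "x + h n" x] h0[of n] by (simp add: divide_le_eq)
    then show "norm (s n x) \<le> indicator {a..b} x * L"
      using h0[of n] by (auto simp: s_def indicator_def abs_divide)
  qed
  have m1: "(\<lambda>x. indicator {a..b} x * f' x) \<in> borel_measurable lborel" by measurable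
  have m2: "s n \<in> borel_measurable lborel" for n unfolding s_def by measurable
  have w: "integrable lborel (\<lambda>x. indicator {a..b} x * L)"
    by (intro integrable_mult_left integrable_real_indicator) (auto simp: ab emeasure_lborel_Icc)
  show 1: "set_integrable lborel {a..b} f'"
    using integrable_dominated_convergence[OF m1 m2 w lim1 bd] by (simp add: set_integrable_def)
  have "(\<lambda>n. integral\<^sup>L lborel (s n)) \<longlonglongrightarrow> (\<integral>x. indicator {a..b} x * f' x \<partial>lborel)"
    using integral_dominated_convergence[OF m1 m2 w lim1 bd] .
  \<comment> \<open>Each endpoint term is a difference quotient of \<open>G\<close>, whose
    derivative there is \<open>F\<close>.\<close>
  moreover have "(\<lambda>n. integral\<^sup>L lborel (s n)) \<longlonglongrightarrow> F b - F a"
    unfolding int_s(2) using ab by (intro tendsto_diff quot G') auto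
  ultimately show "(LBINT x:{a..b}. f' x) = f b - f a"
    using LIMSEQ_unique F_eq[of a] F_eq[of b] ab by (auto simp: set_lebesgue_integral_def)
qed

text \<open>\<open>L\<close> is total as a HOL function but constrained only on functions bounded on
  \<open>S\<close>. That it depends only on the values on \<open>S\<close> is a consequence of
  positivity (\<open>L_cong\<close>).\<close>

locale positive_functional =
  fixes S :: "real set" and L :: "(real \<Rightarrow> real) \<Rightarrow> real"
  assumes L_add: "bounded (\<phi> ` S) \<Longrightarrow> bounded (\<psi> ` S) \<Longrightarrow> L (\<lambda>x. \<phi> x + \<psi> x) = L \<phi> + L \<psi>"
    and L_scale: "bounded (\<phi> ` S) \<Longrightarrow> L (\<lambda>x. t * \<phi> x) = t * L \<phi>"
    and L_nonneg: "bounded (\<phi> ` S) \<Longrightarrow> (\<And>x. x \<in> S \<Longrightarrow> 0 \<le> \<phi> x) \<Longrightarrow> 0 \<le> L \<phi>"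
begin

lemma bounded_fun [simp]:
  fixes \<phi> \<psi> :: "real \<Rightarrow> real" and c :: real
  shows "bounded ((\<lambda>x. c) ` S)"
    and "bounded (\<phi> ` S) \<Longrightarrow> bounded ((\<lambda>x. c * \<phi> x) ` S)"
    and "bounded (\<phi> ` S) \<Longrightarrow> bounded (\<psi> ` S) \<Longrightarrow> bounded ((\<lambda>x. \<phi> x + \<psi> x) ` S)"
    and "bounded (\<phi> ` S) \<Longrightarrow> bounded (\<psi> ` S) \<Longrightarrow> bounded ((\<lambda>x. \<phi> x - \<psi> x) ` S)"
proof -
  show "bounded ((\<lambda>x. c) ` S)" by (rule boundedI[of _ "\<bar>c\<bar>"]) auto
  show "bounded (\<phi> ` S) \<Longrightarrow> bounded ((\<lambda>x. c * \<phi> x) ` S)"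
    using bounded_scaling[of "\<phi> ` S" c] by (simp add: image_image)
qed (auto intro: bounded_plus_comp bounded_minus_comp)

lemma L_diff:
  assumes "bounded (\<phi> ` S)" "bounded (\<psi> ` S)"
  shows "L (\<lambda>x. \<phi> x - \<psi> x) = L \<phi> - L \<psi>"
  using L_add[OF assms(1) bounded_fun(2)[OF assms(2), of "-1"]] L_scale[OF assms(2), of "-1"] by simp

lemma L_const: "L (\<lambda>x. c) = c * L (\<lambda>x. 1)"
  using L_scale[of "\<lambda>x. 1" c] by simp

lemma L_mono:
  assumes "bounded (\<phi> ` S)" "bounded (\<psi> ` S)" "\<And>x. x \<in> S \<Longrightarrow> \<phi> x \<le> \<psi> x"
  shows "L \<phi> \<le> L \<psi>"
proof -
  have "0 \<le> L (\<lambda>x. \<psi> x - \<phi> x)" using assms by (intro L_nonneg bounded_fun) auto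
  then show ?thesis using assms by (simp add: L_diff)
qed

lemma L_cong:
  assumes "bounded (\<phi> ` S)" "\<And>x. x \<in> S \<Longrightarrow> \<phi> x = \<psi> x"
  shows "L \<phi> = L \<psi>"
proof -
  have "bounded (\<psi> ` S)" using assms by (metis image_cong)
  with assms show ?thesis by (intro antisym L_mono) auto
qed

lemma L_abs:
  assumes "bounded (\<phi> ` S)" "bounded (\<psi> ` S)" "\<And>x. x \<in> S \<Longrightarrow> \<bar>\<phi> x\<bar> \<le> \<psi> x"
  shows "\<bar>L \<phi>\<bar> \<le> L \<psi>"
proof -
  have "L (\<lambda>x. (-1) * \<psi> x) \<le> L \<phi>"
    using assms by (intro L_mono bounded_fun) force+
  then have "- L \<psi> \<le> L \<phi>" using L_scale[OF assms(2), of "-1"] by simp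
  moreover have "L \<phi> \<le> L \<psi>" using assms by (intro L_mono) force+
  ultimately show ?thesis by simp
qed

definition \<Phi> :: "real \<Rightarrow> real" where
  "\<Phi> s = L (indicat_real {..s})"

lemma bounded_step [simp]: "bounded (indicat_real A ` S)"
  by (rule boundedI[of _ 1]) (auto simp: indicator_def)

lemma mono_\<Phi>: "mono \<Phi>"
  unfolding \<Phi>_def by (intro monoI L_mono bounded_step) (auto simp: indicator_def)

text \<open>If no point of \<open>S\<close> separates \<open>s\<close> from \<open>t\<close>, the
  two indicators agree on \<open>S\<close>, and \<open>L\<close> cannot tell them apart.\<close>

lemma \<Phi>_eq:
  assumes "\<And>x. x \<in> S \<Longrightarrow> x \<le> s \<longleftrightarrow> x \<le> t"
  shows "\<Phi> s = \<Phi> t"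
  unfolding \<Phi>_def by (intro L_cong bounded_step) (auto simp: indicator_def assms)

lemma \<Phi>_neg:
  assumes "S \<subseteq> {0..}" "s < 0"
  shows "\<Phi> s = 0"
proof -
  have "\<Phi> s = L (\<lambda>x. 0 * indicat_real {..s} x)"
    unfolding \<Phi>_def by (intro L_cong bounded_step) (use assms in \<open>auto simp: indicator_def\<close>)
  also have "\<dots> = 0" by (subst L_scale) auto
  finally show ?thesis .
qed

text \<open>\<open>L K\<close> is the Stieltjes integral of \<open>K\<close> against
  \<open>\<Phi>\<close>, here integrated by parts so that \<open>\<Phi>\<close> becomes an ordinary
  integrand. \<open>L\<close> is only finitely additive; the smoothness of \<open>K\<close> makes up
  for this through increment estimates uniform in \<open>x\<close>.\<close>

lemma stieltjes_representation:
  assumes S: "S \<subseteq> {0..N}" and N: "0 \<le> N"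
    and K: "\<And>x. x \<in> {0..N} \<Longrightarrow> (K has_real_derivative k x) (at x within {0..N})"
    and k: "continuous_on {0..N} k"
  shows "set_integrable lborel {0..N} (\<lambda>s. k s * \<Phi> s)"
    and "L K = K N * \<Phi> N - (LBINT s:{0..N}. k s * \<Phi> s)"
proof -
  have contK: "continuous_on {0..N} K"
    by (rule DERIV_continuous_on[OF K])
  have "bounded (k ` {0..N})" "bounded (K ` {0..N})"
    by (intro compact_imp_bounded compact_continuous_image k contK compact_Icc)+
  then obtain C BK where C: "\<And>x. x \<in> {0..N} \<Longrightarrow> \<bar>k x\<bar> \<le> C" and BK: "\<And>x. x \<in> {0..N} \<Longrightarrow> \<bar>K x\<bar> \<le> BK"
    unfolding bounded_iff by (auto simp del: atLeastAtMost_iff)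
  have C0: "0 \<le> C" using C[of 0] N by auto
  have mvt: "\<exists>z\<in>{x..y}. K y - K x = (y - x) * k z" if "0 \<le> x" "x \<le> y" "y \<le> N" for x y
  proof (cases "x = y")
    case False
    then have "x < y" using that by simp
    have "\<exists>z\<in>{x<..<y}. K y - K x = (\<lambda>h. h * k z) (y - x)"
    proof (rule mvt_simple[OF \<open>x < y\<close>])
      fix z assume "x \<le> z" "z \<le> y"
      then show "(K has_derivative (\<lambda>h. h * k z)) (at z within {x..y})"
        using DERIV_subset[OF K[of z], of "{x..y}"] that
        by (auto simp: has_field_derivative_def mult_commute_abs)
    qed
    then show ?thesis by force
  qed auto
  define M where "M = \<Phi> N"
  have one: "L (\<lambda>x. 1) = M" unfolding M_def \<Phi>_def
    by (intro L_cong[symmetric] bounded_step) (use S in \<open>auto simp: indicator_def\<close>)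
  have \<Phi>0: "0 \<le> \<Phi> s" for s unfolding \<Phi>_def by (intro L_nonneg bounded_step) auto
  have M0: "0 \<le> M" unfolding M_def by (rule \<Phi>0)
  have \<Phi>M: "\<Phi> s \<le> M" for s
    unfolding one[symmetric] \<Phi>_def by (intro L_mono bounded_step bounded_fun) (auto simp: indicator_def)
  \<comment> \<open>Truncating at \<open>y\<close> gives a function that is Lipschitz in \<open>y\<close>, with derivative \<open>k y * \<Phi> y\<close>
    wherever \<open>\<Phi>\<close> is continuous, and that runs from \<open>0\<close> to \<open>K N * \<Phi> N - L K\<close>.\<close>
  define A where "A y = L (\<lambda>x. K y - K (min x y))" for y
  have bK: "bounded ((\<lambda>x. K (min x y)) ` S)" if "y \<in> {0..N}" for y
    by (rule boundedI[of _ BK]) (use S that in \<open>auto intro!: BK simp: min_def\<close>)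
  note bm = bounded_fun
  \<comment> \<open>For \<open>x \<le> y\<close> the truncated function grows by
    \<open>K y' - K y\<close>, which the mean value theorem puts within \<open>(y' - y) * e\<close>
    of \<open>(y' - y) * k c\<close>. For \<open>x > y'\<close> it stays zero. In the gap it is at
    most \<open>(y' - y) * C\<close>, and \<open>L\<close> gives the gap the mass
    \<open>\<Phi> y' - \<Phi> y\<close>. Leaving \<open>c\<close> free lets it be either
    endpoint.\<close>
  have incr: "\<bar>A y' - A y - (y' - y) * (k c * \<Phi> y)\<bar> \<le> (y' - y) * (e * M + C * (\<Phi> y' - \<Phi> y))"
    if y: "0 \<le> y" "y \<le> y'" "y' \<le> N" "c \<in> {0..N}" and e: "\<And>z. z \<in> {y..y'} \<Longrightarrow> \<bar>k z - k c\<bar> \<le> e" for y y' c e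
  proof -
    have e0: "0 \<le> e" using e[of y] y by auto
    define D where "D x = (K y' - K (min x y')) - (K y - K (min x y)) - ((y' - y) * k c) * indicat_real {..y} x" for x
    define E where "E x = ((y' - y) * e) * 1 + ((y' - y) * C) * (indicat_real {..y'} x - indicat_real {..y} x)" for x
    have LD: "L D = A y' - A y - ((y' - y) * k c) * \<Phi> y"
      unfolding D_def A_def \<Phi>_def using y by (simp add: L_diff L_scale bm bK)
    have LE: "L E = ((y' - y) * e) * M + ((y' - y) * C) * (\<Phi> y' - \<Phi> y)"
      unfolding E_def A_def \<Phi>_def one[symmetric] using y by (subst L_add) (simp_all add: L_diff L_scale bm bK L_const[of e])
    have "\<bar>L D\<bar> \<le> L E"
    proof (rule L_abs)
      show "bounded (D ` S)" "bounded (E ` S)" unfolding D_def[abs_def] E_def[abs_def] using y by (simp_all add: bm bK)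
      fix x assume "x \<in> S"
      then have x: "0 \<le> x" "x \<le> N" using S by auto
      consider "x \<le> y" | "y < x" "x \<le> y'" | "y' < x" by linarith
      then show "\<bar>D x\<bar> \<le> E x"
      proof cases
        case 1
        obtain z where "z \<in> {y..y'}" "K y' - K y = (y' - y) * k z" using mvt[of y y'] y by auto
        then have "D x = (y' - y) * (k z - k c)" "\<bar>k z - k c\<bar> \<le> e" using 1 y e by (auto simp: D_def algebra_simps)
        then show ?thesis using 1 y by (auto simp: E_def abs_mult intro!: mult_left_mono)
      next
        case 2
        obtain z where z: "z \<in> {x..y'}" "K y' - K x = (y' - x) * k z" using mvt[of x y'] y x 2 by auto
        have "\<bar>D x\<bar> = (y' - x) * \<bar>k z\<bar>" using 2 z by (simp add: D_def abs_mult)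
        also have "\<dots> \<le> (y' - y) * C" using z x y 2 by (intro mult_mono C) auto
        also have "\<dots> \<le> E x" using 2 e0 y by (simp add: E_def)
        finally show ?thesis .
      next
        case 3
        then show ?thesis using y e0 by (simp add: D_def E_def)
      qed
    qed
    then show ?thesis unfolding LD LE by (simp add: algebra_simps)
  qed
  \<comment> \<open>With \<open>c = y\<close> and oscillation bound \<open>2 * C\<close>, the error
    contributes at most \<open>3 * C * M\<close> and the main term \<open>C * M\<close>.\<close>
  have lip: "(4 * C * M)-lipschitz_on {0..N} A"
  proof -
    have half: "\<bar>A y' - A y\<bar> \<le> 4 * C * M * (y' - y)" if y: "0 \<le> y" "y \<le> y'" "y' \<le> N" for y y'
    proof -
      have "\<bar>k z - k y\<bar> \<le> 2 * C" if "z \<in> {y..y'}" for z using C[of z] C[of y] that y by force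
      from incr[OF y _ this] have "\<bar>A y' - A y - (y' - y) * (k y * \<Phi> y)\<bar> \<le> (y' - y) * (2 * C * M + C * (\<Phi> y' - \<Phi> y))"
        using y by simp
      moreover have "(y' - y) * (2 * C * M + C * (\<Phi> y' - \<Phi> y)) \<le> (y' - y) * (2 * C * M + C * M)"
        using \<Phi>0[of y] \<Phi>M[of y'] y C0 by (intro mult_left_mono add_left_mono) auto
      moreover have "\<bar>(y' - y) * (k y * \<Phi> y)\<bar> \<le> (y' - y) * (C * M)"
        unfolding abs_mult using \<Phi>0[of y] \<Phi>M[of y] y C[of y] C0 M0 by (intro mult_mono) auto
      ultimately show ?thesis by (simp add: algebra_simps)
    qed
    show ?thesis
    proof (rule lipschitz_onI)
      fix x y assume "x \<in> {0..N}" "y \<in> {0..N}"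
      then show "dist (A x) (A y) \<le> 4 * C * M * dist x y"
        using half[of x y] half[of y x] by (cases "x \<le> y") (auto simp: dist_real_def abs_minus_commute)
    qed (use C0 M0 in auto)
  qed
  \<comment> \<open>The cutoff of \<open>k\<close> is Borel on the whole line, as the fundamental
    theorem above demands.\<close>
  define k' where "k' s = indicator {0..N} s *\<^sub>R k s" for s
  have kk: "k' s = k s" if "s \<in> {0..N}" for s using that by (simp add: k'_def)
  have [measurable]: "k' \<in> borel_measurable borel"
    using borel_measurable_continuous_on_indicator[OF _ k] by (simp add: k'_def[abs_def])
  have [measurable]: "\<Phi> \<in> borel_measurable borel" by (rule borel_measurable_mono[OF mono_\<Phi>])
  have der: "(A has_real_derivative k' c * \<Phi> c) (at c)" if c: "c \<in> {0<..<N}" and cont: "isCont \<Phi> c" for c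
    unfolding DERIV_def LIM_eq
  proof (intro allI impI)
    fix r :: real assume r: "r > 0"
    \<comment> \<open>Both signs of the step lead to an error of at most
      \<open>e * (M + 3 * C)\<close> in the difference quotient; this choice keeps it strictly below
      \<open>r\<close>.\<close>
    define e where "e = r / (2 * (M + 3 * C + 1))"
    have den: "M + 3 * C + 1 > 0" using M0 C0 by auto
    have e: "e > 0" using r den by (simp add: e_def)
    have "isCont k c" using continuous_on_interior[OF k, of c] c by simp
    then obtain d1 where d1: "d1 > 0" "\<And>z. \<bar>z - c\<bar> < d1 \<Longrightarrow> \<bar>k z - k c\<bar> < e"
      using e by (fastforce simp: continuous_at_eps_delta dist_real_def)
    obtain d2 where d2: "d2 > 0" "\<And>z. \<bar>z - c\<bar> < d2 \<Longrightarrow> \<bar>\<Phi> z - \<Phi> c\<bar> < e"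
      using e cont by (fastforce simp: continuous_at_eps_delta dist_real_def)
    define d where "d = min (min d1 d2) (min c (N - c))"
    have d: "d > 0" using d1 d2 c by (simp add: d_def)
    have cN: "c \<in> {0..N}" using c by auto
    show "\<exists>s>0. \<forall>x. x \<noteq> 0 \<and> norm (x - 0) < s \<longrightarrow> norm ((A (c + x) - A c) / x - k' c * \<Phi> c) < r"
    proof (intro exI[of _ d] conjI d allI impI)
      fix h :: real assume "h \<noteq> 0 \<and> norm (h - 0) < d"
      then have h: "h \<noteq> 0" "\<bar>h\<bar> < d" by auto
      then have hd: "\<bar>h\<bar> < d1" "\<bar>h\<bar> < d2" "\<bar>h\<bar> < c" "\<bar>h\<bar> < N - c" by (auto simp: d_def)
      have \<Phi>h: "\<bar>\<Phi> (c + h) - \<Phi> c\<bar> < e" using d2(2)[of "c + h"] hd by simp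
      have "\<bar>A (c + h) - A c - h * (k c * \<Phi> c)\<bar> \<le> \<bar>h\<bar> * (e * (M + 3 * C))"
      proof (cases "h > 0")
        case True
        have "\<bar>k z - k c\<bar> \<le> e" if "z \<in> {c..c+h}" for z using d1(2)[of z] that hd True by force
        from incr[OF _ _ _ cN this, of "c" "c + h"] 
        have "\<bar>A (c + h) - A c - h * (k c * \<Phi> c)\<bar> \<le> h * (e * M + C * (\<Phi> (c + h) - \<Phi> c))"
          using True hd c by simp
        also have "\<dots> \<le> h * (e * M + (3 * C) * e)"
          using True \<Phi>h C0 e monoD[OF mono_\<Phi>, of c "c + h"] by (intro mult_left_mono add_left_mono mult_mono) auto
        finally show ?thesis using True by (simp add: algebra_simps)
      next
        case False
        then have hn: "h < 0" using h by simp
        have "\<bar>k z - k c\<bar> \<le> e" if "z \<in> {c+h..c}" for z using d1(2)[of z] that hd hn by force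
        from incr[OF _ _ _ cN this, of "c + h" "c"] 
        have 1: "\<bar>A c - A (c + h) - (- h) * (k c * \<Phi> (c + h))\<bar> \<le> (- h) * (e * M + C * (\<Phi> c - \<Phi> (c + h)))"
          using hn hd c by simp
        \<comment> \<open>For a negative step the increment runs over \<open>{c+h..c}\<close>, so
          its main term carries \<open>\<Phi> (c + h)\<close>; replacing it by
          \<open>\<Phi> c\<close> costs another \<open>C * e\<close>.\<close>
        have 2: "\<bar>h * (k c * (\<Phi> (c + h) - \<Phi> c))\<bar> \<le> (- h) * (C * e)"
          unfolding abs_mult using hn \<Phi>h C[OF cN] C0 by (intro mult_mono) auto
        have 3: "(- h) * (e * M + C * (\<Phi> c - \<Phi> (c + h))) \<le> (- h) * (e * M + (2 * C) * e)"
          using hn \<Phi>h C0 e monoD[OF mono_\<Phi>, of "c + h" c] by (intro mult_left_mono add_left_mono mult_mono) auto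
        have "A (c + h) - A c - h * (k c * \<Phi> c) = - (A c - A (c + h) - (- h) * (k c * \<Phi> (c + h))) + h * (k c * (\<Phi> (c + h) - \<Phi> c))"
          by (simp add: algebra_simps)
        with 1 2 3 have "\<bar>A (c + h) - A c - h * (k c * \<Phi> c)\<bar> \<le> (- h) * (e * M + (2 * C) * e) + (- h) * (C * e)" 
          by linarith
        then show ?thesis using hn by (simp add: algebra_simps)
      qed
      then have "\<bar>(A (c + h) - A c) / h - k c * \<Phi> c\<bar> \<le> e * (M + 3 * C)"
        using h(1) by (simp add: field_simps flip: abs_divide) (simp add: abs_divide field_simps)
      also have "\<dots> < e * (2 * (M + 3 * C + 1))" using M0 C0 e by (intro mult_strict_left_mono) auto
      also have "\<dots> = r" using den by (simp add: e_def)
      finally show "norm ((A (c + h) - A c) / h - k' c * \<Phi> c) < r" using kk[OF cN] by simp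
    qed
  qed
  have "{a. \<not> isCont \<Phi> a} \<in> null_sets lborel"
    by (rule countable_imp_null_set_lborel[OF mono_ctble_discont[OF mono_\<Phi>]])
  then have "AE c in lborel. isCont \<Phi> c" by (rule AE_I') auto
  then have AEd: "AE c in lborel. c \<in> {0<..<N} \<longrightarrow> (A has_real_derivative k' c * \<Phi> c) (at c)"
    by eventually_elim (use der in blast)
  have eq: "set_integrable lborel {0..N} (\<lambda>s. k s * \<Phi> s) = set_integrable lborel {0..N} (\<lambda>s. k' s * \<Phi> s)"
     "(LBINT s:{0..N}. k s * \<Phi> s) = (LBINT s:{0..N}. k' s * \<Phi> s)"
    by (rule set_integrable_cong set_lebesgue_integral_cong; simp add: kk)+
  have "set_integrable lborel {0..N} (\<lambda>s. k' s * \<Phi> s)" "(LBINT s:{0..N}. k' s * \<Phi> s) = A N - A 0"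
    by (rule lipschitz_fundamental_theorem[OF N lip AEd]; measurable)+
  moreover have "A 0 = L (\<lambda>x. 0 * 1)" unfolding A_def
    by (rule L_cong[OF bounded_fun(4)[OF bounded_fun(1) bK]]) (use S N in \<open>auto simp: min_def\<close>)
  then have "A 0 = 0" by (subst (asm) L_scale) auto
  moreover have "A N = L (\<lambda>x. K N * 1 - K x)" unfolding A_def
    by (rule L_cong[OF bounded_fun(4)[OF bounded_fun(1) bK]]) (use S N in \<open>auto simp: min_def\<close>)
  moreover have "bounded (K ` S)" by (rule boundedI[of _ BK]) (use S in \<open>auto intro: BK\<close>)
  then have "L (\<lambda>x. K N * 1 - K x) = K N * M - L K"
    by (subst L_diff) (auto simp: L_const[of "K N"] one)
  ultimately show "set_integrable lborel {0..N} (\<lambda>s. k s * \<Phi> s)"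
    and "L K = K N * \<Phi> N - (LBINT s:{0..N}. k s * \<Phi> s)"
    by (auto simp: eq M_def)
qed

end

section \<open>The measure of a monotone function\<close>

lemma AE_isCont_mono:
  fixes \<Phi> :: "real \<Rightarrow> real"
  assumes "mono \<Phi>"
  shows "AE x in lborel. isCont \<Phi> (x - c)"
proof -
  have "{x. \<not> isCont \<Phi> (x - c)} \<subseteq> (\<lambda>x. x + c) ` {x. \<not> isCont \<Phi> x}"
    by (auto intro!: image_eqI[of _ _ "_ - c"])
  then have "countable {x. \<not> isCont \<Phi> (x - c)}"
    using mono_ctble_discont[OF assms] countable_subset by blast
  then have "{x. \<not> isCont \<Phi> (x - c)} \<in> null_sets lborel"
    by (rule countable_imp_null_set_lborel)
  then show ?thesis by (rule AE_I') auto
qed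

text \<open>The measure is built from the right limits \<open>F\<close> of \<open>\<Phi>\<close>,
  which agree with \<open>\<Phi>\<close> wherever it is continuous. The closed interval
  \<open>{x-1..x}\<close> has the mass of the half-open one as soon as \<open>\<Phi>\<close> is
  continuous at \<open>x - 1\<close>, hence for almost every \<open>x\<close>.\<close>

lemma stieltjes_measure:
  fixes \<Phi> :: "real \<Rightarrow> real"
  assumes mono: "mono \<Phi>" and C: "closed C" "C \<subseteq> {p..q}"
    and const: "\<And>s t. s \<le> t \<Longrightarrow> C \<inter> {s<..t} = {} \<Longrightarrow> \<Phi> s = \<Phi> t"
  obtains f where "sets f = sets borel" "finite_measure f" "emeasure f (- C) = 0" "msupp f \<subseteq> C"
    "AE x in lborel. measure f {x-1..x} = \<Phi> x - \<Phi> (x - 1)"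
proof -
  define F where "F x = Inf (\<Phi> ` {x<..})" for x
  have bdd: "bdd_below (\<Phi> ` {x<..})" for x
    using monoD[OF mono] by (intro bdd_belowI[of _ "\<Phi> x"]) auto
  have F_le: "F x \<le> \<Phi> y" if "x < y" for x y
    unfolding F_def using that by (intro cInf_lower bdd) auto
  have F_ge: "z \<le> F x" if "\<And>y. x < y \<Longrightarrow> z \<le> \<Phi> y" for x z
    unfolding F_def using that by (intro cInf_greatest) auto
  have \<Phi>_F: "\<Phi> x \<le> F x" for x using monoD[OF mono] by (intro F_ge) auto
  have F_mono: "F x \<le> F y" if "x \<le> y" for x y
    using that by (intro F_ge F_le) auto
  have F_right: "continuous (at_right a) F" for a
    unfolding continuous_within
  proof (rule order_tendstoI)
    fix l assume "l < F a"
    then have "\<forall>y>a. l < F y" using F_mono[of a] by (auto intro: less_le_trans)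
    then show "eventually (\<lambda>x. l < F x) (at_right a)"
      by (auto simp: eventually_at_filter intro: always_eventually)
  next
    fix u assume "F a < u"
    then obtain y where "a < y" "\<Phi> y < u"
      using F_ge[of a u] by force
    then have "\<forall>x>a. x < y \<longrightarrow> F x < u" using F_le by (auto intro: le_less_trans)
    then show "eventually (\<lambda>x. F x < u) (at_right a)"
      using \<open>a < y\<close> by (auto simp: eventually_at_right)
  qed
  have F_eq: "F x = \<Phi> x" if "isCont \<Phi> x" for x
  proof (rule antisym[OF _ \<Phi>_F])
    have "(\<Phi> \<longlongrightarrow> \<Phi> x) (at_right x)"
      using that by (simp add: isCont_def filterlim_at_split)
    then show "F x \<le> \<Phi> x"
      by (rule tendsto_lowerbound) (auto simp: eventually_at_filter F_le)
  qed
  define f where "f = interval_measure F"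
  have sf [measurable_cong]: "sets f = sets borel" by (simp add: f_def)
  have Ioc: "emeasure f {s<..t} = F t - F s" "measure f {s<..t} = F t - F s" if "s \<le> t" for s t
    unfolding f_def using that F_mono F_right
    by (auto intro!: emeasure_interval_measure_Ioc measure_interval_measure_Ioc)
  \<comment> \<open>\<open>F t\<close> sees \<open>\<Phi>\<close> to the right of \<open>t\<close>,
    so the gap in \<open>C\<close> has to extend beyond \<open>t\<close>.\<close>
  have null: "emeasure f {s<..t} = 0" if st: "s \<le> t" "t < t'" "C \<inter> {s<..<t'} = {}" for s t t'
  proof -
    obtain m where m: "t < m" "m < t'" using dense[OF st(2)] by blast
    have "\<Phi> m \<le> F s"
    proof (rule F_ge)
      fix y assume "s < y"
      show "\<Phi> m \<le> \<Phi> y"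
      proof (cases "y \<le> m")
        case True
        then have "\<Phi> y = \<Phi> m" using \<open>s < y\<close> st m by (intro const) auto
        then show ?thesis by simp
      qed (use monoD[OF mono] in auto)
    qed
    then have "F t = F s" using F_le[OF m(1)] F_mono[OF st(1)] by linarith
    then show ?thesis using Ioc(1)[OF st(1)] by simp
  qed
  have loc: "\<exists>e>0. emeasure f (ball x e) = 0" if "x \<notin> C" for x
  proof -
    have "open (- C)" "x \<in> - C" using C that by auto
    then obtain e where e: "e > 0" "ball x e \<subseteq> - C" by (rule openE)
    have "{x - e/2<..<x + e} \<subseteq> ball x e" using e(1) by (auto simp: ball_eq_greaterThanLessThan)
    then have "C \<inter> {x - e/2<..<x + e} = {}" using e(2) by blast
    then have "emeasure f {x - e/2<..x + e/2} = 0"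
      using e by (intro null[of _ _ "x + e"]) auto
    moreover have "ball x (e/2) \<subseteq> {x - e/2<..x + e/2}" by (auto simp: ball_eq_greaterThanLessThan)
    ultimately have "emeasure f (ball x (e/2)) = 0"
      using emeasure_mono[of "ball x (e/2)" "{x - e/2<..x + e/2}" f] by (simp add: sf)
    with e show ?thesis by (intro exI[of _ "e/2"]) auto
  qed
  have supp: "msupp f \<subseteq> C"
  proof
    fix x assume "x \<in> msupp f"
    then show "x \<in> C" using loc[of x] by (force simp: msupp_def)
  qed
  have nullC: "emeasure f (- C) = 0"
  proof -
    \<comment> \<open>By the Lindelof property countably many open null sets cover the complement of
      \<open>C\<close>, which turns local nullity into global nullity.\<close>
    define U where "U = {B. open B \<and> emeasure f B = 0}"
    obtain U' where U': "U' \<subseteq> U" "countable U'" "\<Union>U' = \<Union>U"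
      using Lindelof[of U] by (auto simp: U_def)
    have "(\<Union>B\<in>U'. B) \<in> null_sets f"
    proof (rule null_sets_UN'[OF U'(2)])
      fix B assume "B \<in> U'"
      then have "open B" "emeasure f B = 0" using U'(1) by (auto simp: U_def)
      then show "B \<in> null_sets f" by (simp add: null_sets_def sf)
    qed
    moreover have "- C \<subseteq> \<Union>U"
    proof
      fix x assume "x \<in> - C"
      then obtain e where "e > 0" "emeasure f (ball x e) = 0" using loc by blast
      then show "x \<in> \<Union>U" by (auto simp: U_def intro!: exI[of _ "ball x e"])
    qed
    ultimately have "emeasure f (- C) \<le> 0"
      using emeasure_mono[of "- C" "\<Union>U'" f] U'(3) by (auto simp: null_sets_def)
    then show ?thesis by simp
  qed
  have fin: "finite_measure f"
  proof (rule finite_measureI)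
    have sp: "space f = UNIV" by (simp add: f_def)
    \<comment> \<open>\<open>max p q\<close> keeps the endpoints in order even if
      \<open>{p..q}\<close> is empty, as the formula for the mass requires.\<close>
    have "emeasure f UNIV \<le> emeasure f ({p - 1<..max p q} \<union> - C)"
      using C by (intro emeasure_mono) (auto simp: sf)
    also have "\<dots> \<le> emeasure f {p - 1<..max p q} + emeasure f (- C)"
      using C(1) by (intro emeasure_subadditive) (auto simp: sf)
    also have "\<dots> < \<infinity>" by (subst Ioc) (auto simp: nullC)
    finally show "emeasure f (space f) \<noteq> \<infinity>" by (simp add: sp)
  qed
  interpret finite_measure f by (rule fin)
  have "AE x in lborel. measure f {x-1..x} = \<Phi> x - \<Phi> (x - 1)"
    using AE_isCont_mono[OF mono, of 0] AE_isCont_mono[OF mono, of 1]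
  proof eventually_elim
    case (elim x)
    then have c: "isCont \<Phi> x" "isCont \<Phi> (x - 1)" by auto
    show ?case
    proof (rule antisym)
      have "\<Phi> x - \<Phi> (x - 1) = measure f {x-1<..x}" using c by (simp add: Ioc F_eq)
      also have "\<dots> \<le> measure f {x-1..x}" by (intro finite_measure_mono) (auto simp: sf)
      finally show "\<Phi> x - \<Phi> (x - 1) \<le> measure f {x-1..x}" .
      \<comment> \<open>The left endpoint carries no mass: enclose the closed interval in
        \<open>{y<..x}\<close> and let \<open>y\<close> tend to \<open>x - 1\<close> from the left,
        where \<open>\<Phi>\<close> is continuous.\<close>
      have "measure f {x-1..x} \<le> \<Phi> x - \<Phi> y" if "y < x - 1" for y
      proof -
        have "measure f {x-1..x} \<le> measure f {y<..x}"
          using that by (intro finite_measure_mono) (auto simp: sf)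
        also have "\<dots> \<le> \<Phi> x - \<Phi> y" using that \<Phi>_F[of y] c by (simp add: Ioc F_eq)
        finally show ?thesis .
      qed
      moreover have "((\<lambda>y. \<Phi> x - \<Phi> y) \<longlongrightarrow> \<Phi> x - \<Phi> (x - 1)) (at_left (x - 1))"
        using c(2) by (intro tendsto_intros) (simp add: isCont_def filterlim_at_split)
      ultimately show "measure f {x-1..x} \<le> \<Phi> x - \<Phi> (x - 1)"
        by (intro tendsto_lowerbound[of _ _ "at_left (x - 1)"]) (auto simp: eventually_at_filter)
    qed
  qed
  then show thesis by (rule that[OF sf fin nullC supp])
qed

section \<open>The first variation\<close>

lemma C1_UNIV_derivD:
  fixes f :: "real \<Rightarrow> real"
  assumes "f C1_differentiable_on UNIV"
  shows "(f has_real_derivative deriv f x) (at x)" and "continuous_on UNIV (deriv f)"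
proof -
  obtain D where D: "\<And>x. (f has_vector_derivative D x) (at x)" "continuous_on UNIV D"
    using assms by (auto simp: C1_differentiable_on_def)
  have D': "(f has_real_derivative D x) (at x)" for x
    using D(1) by (simp add: has_real_derivative_iff_has_vector_derivative)
  then have "deriv f = D" by (auto intro: DERIV_imp_deriv)
  with D' D(2) show "(f has_real_derivative deriv f x) (at x)" "continuous_on UNIV (deriv f)" by auto
qed

text \<open>Dominated convergence for the difference quotients of the energy. The Lipschitz
  constants of \<open>a\<close> and \<open>b\<close> and the bounds on \<open>U\<close> and
  \<open>V\<close> provide an integrable majorant that does not depend on the step.\<close>

lemma directional_derivative_nonneg:
  fixes a b U V g z :: "real \<Rightarrow> real"
  assumes a_C1: "a C1_differentiable_on UNIV" and b_C1: "b C1_differentiable_on UNIV"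
    and a_lip: "La-lipschitz_on UNIV a" and b_lip: "Lb-lipschitz_on UNIV b"
    and [measurable]: "U \<in> borel_measurable borel" "V \<in> borel_measurable borel"
      "g \<in> borel_measurable borel" "z \<in> borel_measurable borel"
    and UB: "\<And>x. \<bar>U x\<bar> \<le> B" and VB: "\<And>x. \<bar>V x\<bar> \<le> B"
    and g2: "set_integrable lborel {0..T} (\<lambda>x. (g x)\<^sup>2)"
    and z2: "set_integrable lborel {0..T} (\<lambda>x. (z x)\<^sup>2)"
    and ge: "\<And>h. 0 < h \<Longrightarrow> h \<le> h0 \<Longrightarrow> (LBINT x:{0..T}. a (U x) * (g x)\<^sup>2 + b (U x))
        \<le> (LBINT x:{0..T}. a (U x + h * V x) * (g x + h * z x)\<^sup>2 + b (U x + h * V x))"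
    and h0: "h0 > 0"
  shows "0 \<le> (LBINT x:{0..T}. 2 * a (U x) * g x * z x + (deriv a (U x) * (g x)\<^sup>2 + deriv b (U x)) * V x)"
proof -
  have La0: "0 \<le> La" and Lb0: "0 \<le> Lb" using a_lip b_lip by (auto dest: lipschitz_on_nonneg)
  have B0: "0 \<le> B" using UB[of 0] by linarith
  have conta: "continuous_on UNIV a" and contb: "continuous_on UNIV b"
    using lipschitz_on_continuous_on a_lip b_lip by auto
  have [measurable]: "a \<in> borel_measurable borel" "b \<in> borel_measurable borel"
    using conta contb by (auto intro: borel_measurable_continuous_onI)
  have da: "(a has_real_derivative deriv a x) (at x)" and db: "(b has_real_derivative deriv b x) (at x)" for x
    using a_C1 b_C1 by (auto intro: C1_UNIV_derivD)
  have [measurable]: "deriv a \<in> borel_measurable borel" "deriv b \<in> borel_measurable borel"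
    using a_C1 b_C1 by (auto intro: C1_UNIV_derivD borel_measurable_continuous_onI)
  define h where "h n = h0 / real (Suc n)" for n
  have h: "h n > 0" "h n \<le> h0" for n using h0 by (auto simp: h_def field_simps)
  have "(\<lambda>n. h0 * (1 / real (Suc n))) \<longlonglongrightarrow> h0 * 0"
    by (intro tendsto_intros LIMSEQ_Suc[OF lim_1_over_n])
  then have "h \<longlonglongrightarrow> 0" unfolding h_def by simp
  then have h_lim: "filterlim h (at 0) sequentially"
    using h(1) by (auto simp: filterlim_at intro!: always_eventually) (metis less_irrefl)
  have A: "\<bar>a (U x)\<bar> \<le> \<bar>a 0\<bar> + La * B" for x
  proof -
    have "\<bar>a (U x) - a 0\<bar> \<le> La * \<bar>U x\<bar>" using lipschitz_onD[OF a_lip, of "U x" 0] by (simp add: dist_real_def)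
    also have "\<dots> \<le> La * B" by (intro mult_left_mono UB La0)
    finally show ?thesis by linarith
  qed
  define A where "A = \<bar>a 0\<bar> + La * B"
  have bU: "\<bar>b (U x)\<bar> \<le> \<bar>b 0\<bar> + Lb * B" for x
  proof -
    have "\<bar>b (U x) - b 0\<bar> \<le> Lb * \<bar>U x\<bar>" using lipschitz_onD[OF b_lip, of "U x" 0] by (simp add: dist_real_def)
    also have "\<dots> \<le> Lb * B" by (intro mult_left_mono UB Lb0)
    finally show ?thesis by linarith
  qed
  have A0: "0 \<le> A" unfolding A_def using La0 B0 by simp
  define f where "f t x = a (U x + t * V x) * (g x + t * z x)\<^sup>2 + b (U x + t * V x)" for t x
  have f_meas [measurable]: "f t \<in> borel_measurable borel" for t unfolding f_def by measurable
  \<comment> \<open>The three summands bound, per unit step, the effect of changing the coefficient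
    \<open>a\<close>, the squared derivative and \<open>b\<close>; these are the terms
    \<open>p\<close>, \<open>t * q\<close> and \<open>r\<close> in the splitting below.\<close>
  define w where "w x = La * B * (2 * (g x)\<^sup>2 + 2 * h0\<^sup>2 * (z x)\<^sup>2) + A * ((g x)\<^sup>2 + (1 + h0) * (z x)\<^sup>2) + Lb * B" for x
  have c_int: "set_integrable lborel {0..T} (\<lambda>x. c)" for c :: real
    by (simp add: set_integrable_def emeasure_lborel_Icc_eq)
  have w_int: "set_integrable lborel {0..T} w"
    unfolding w_def[abs_def] by (intro set_integral_add(1) set_integrable_mult_right g2 z2 c_int)
  have bound: "\<bar>(f t x - f 0 x) / t\<bar> \<le> w x" if t: "0 < t" "t \<le> h0" for t x
  proof -
    define p where "p = (a (U x + t * V x) - a (U x)) * (g x + t * z x)\<^sup>2"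
    define q where "q = a (U x) * (2 * g x * z x + t * (z x)\<^sup>2)"
    define r where "r = b (U x + t * V x) - b (U x)"
    have "f t x - f 0 x = p + t * q + r" by (simp add: f_def p_def q_def r_def algebra_simps power2_eq_square)
    moreover have p: "\<bar>p\<bar> \<le> t * (La * B * (2 * (g x)\<^sup>2 + 2 * h0\<^sup>2 * (z x)\<^sup>2))"
    proof -
      have "\<bar>a (U x + t * V x) - a (U x)\<bar> \<le> La * (t * \<bar>V x\<bar>)"
        using lipschitz_onD[OF a_lip, of "U x + t * V x" "U x"] t by (simp add: dist_real_def abs_mult)
      also have "\<dots> \<le> La * (t * B)" using t by (intro mult_left_mono VB La0) auto
      finally have 1: "\<bar>a (U x + t * V x) - a (U x)\<bar> \<le> La * (t * B)" .
      have "(g x + t * z x)\<^sup>2 \<le> 2 * (g x)\<^sup>2 + 2 * (t * z x)\<^sup>2"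
        using zero_le_power2[of "g x - t * z x"] by (simp add: power2_eq_square algebra_simps)
      also have "(t * z x)\<^sup>2 \<le> h0\<^sup>2 * (z x)\<^sup>2"
        unfolding power_mult_distrib using t by (intro mult_right_mono power_mono) auto
      finally have 2: "(g x + t * z x)\<^sup>2 \<le> 2 * (g x)\<^sup>2 + 2 * h0\<^sup>2 * (z x)\<^sup>2" by simp
      have "\<bar>p\<bar> \<le> (La * (t * B)) * (2 * (g x)\<^sup>2 + 2 * h0\<^sup>2 * (z x)\<^sup>2)"
        unfolding p_def abs_mult using 1 2 La0 B0 t by (intro mult_mono) auto
      then show ?thesis by (simp add: algebra_simps)
    qed
    moreover have q: "\<bar>t * q\<bar> \<le> t * (A * ((g x)\<^sup>2 + (1 + h0) * (z x)\<^sup>2))"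
    proof -
      have "\<bar>2 * g x * z x\<bar> \<le> (g x)\<^sup>2 + (z x)\<^sup>2"
        using sum_squares_bound[of "\<bar>g x\<bar>" "\<bar>z x\<bar>"] by (simp add: abs_mult)
      moreover have "\<bar>t * (z x)\<^sup>2\<bar> \<le> h0 * (z x)\<^sup>2" using t by (simp add: mult_right_mono)
      ultimately have "\<bar>2 * g x * z x + t * (z x)\<^sup>2\<bar> \<le> (g x)\<^sup>2 + (1 + h0) * (z x)\<^sup>2"
        by (simp add: algebra_simps)
      then have "\<bar>q\<bar> \<le> A * ((g x)\<^sup>2 + (1 + h0) * (z x)\<^sup>2)"
        unfolding q_def abs_mult using A[of x] A0 by (intro mult_mono) (auto simp: A_def)
      then show ?thesis using t by (simp add: abs_mult)
    qed
    moreover have "\<bar>r\<bar> \<le> t * (Lb * B)"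
    proof -
      have "\<bar>r\<bar> \<le> Lb * (t * \<bar>V x\<bar>)"
        using lipschitz_onD[OF b_lip, of "U x + t * V x" "U x"] t by (simp add: r_def dist_real_def abs_mult)
      also have "\<dots> \<le> Lb * (t * B)" using t by (intro mult_left_mono VB Lb0) auto
      finally show ?thesis by (simp add: algebra_simps)
    qed
    ultimately have "\<bar>f t x - f 0 x\<bar> \<le> t * w x" unfolding w_def by (simp only: distrib_left)
    then show ?thesis using t by (simp add: abs_divide divide_le_eq mult.commute)
  qed
  have f0_int: "set_integrable lborel {0..T} (f 0)"
  proof (rule set_integrable_bound)
    show "set_integrable lborel {0..T} (\<lambda>x. A * (g x)\<^sup>2 + (\<bar>b 0\<bar> + Lb * B))"
      by (intro set_integral_add(1) set_integrable_mult_right g2 c_int)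
    show "set_borel_measurable lborel {0..T} (f 0)" unfolding set_borel_measurable_def by measurable
    have "\<bar>f 0 x\<bar> \<le> A * (g x)\<^sup>2 + (\<bar>b 0\<bar> + Lb * B)" for x
    proof -
      have "\<bar>a (U x) * (g x)\<^sup>2\<bar> \<le> A * (g x)\<^sup>2" using A[of x] unfolding abs_mult by (auto simp: A_def intro!: mult_right_mono)
      then show ?thesis using bU[of x] by (simp add: f_def)
    qed
    then show "AE x in lborel. x \<in> {0..T} \<longrightarrow> norm (f 0 x) \<le> norm (A * (g x)\<^sup>2 + (\<bar>b 0\<bar> + Lb * B))"
      by (intro AE_I2) (metis abs_ge_self order_trans real_norm_def)
  qed
  have q_int: "set_integrable lborel {0..T} (\<lambda>x. (f t x - f 0 x) / t)" if t: "0 < t" "t \<le> h0" for t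
  proof (rule set_integrable_bound[OF w_int])
    show "set_borel_measurable lborel {0..T} (\<lambda>x. (f t x - f 0 x) / t)" unfolding set_borel_measurable_def by measurable
    show "AE x in lborel. x \<in> {0..T} \<longrightarrow> norm ((f t x - f 0 x) / t) \<le> norm (w x)"
      using bound[OF t] by (intro AE_I2) (metis abs_ge_self order_trans real_norm_def)
  qed
  define lim where "lim x = 2 * a (U x) * g x * z x + (deriv a (U x) * (g x)\<^sup>2 + deriv b (U x)) * V x" for x
  have lim: "(\<lambda>n. (f (h n) x - f 0 x) / h n) \<longlonglongrightarrow> lim x" for x
  proof -
    have "((\<lambda>t. f t x) has_real_derivative lim x) (at 0)"
      unfolding f_def lim_def
      by (auto intro!: derivative_eq_intros DERIV_chain2[OF da] DERIV_chain2[OF db] simp: power2_eq_square algebra_simps)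
    then show ?thesis unfolding DERIV_def using filterlim_compose[OF _ h_lim] by fastforce
  qed
  have "(\<lambda>n. \<integral>x. indicator {0..T} x * ((f (h n) x - f 0 x) / h n) \<partial>lborel) \<longlonglongrightarrow> (\<integral>x. indicator {0..T} x * lim x \<partial>lborel)"
  proof (rule integral_dominated_convergence)
    show "integrable lborel (\<lambda>x. indicator {0..T} x * w x)" using w_int by (simp add: set_integrable_def)
    show "(\<lambda>x. indicator {0..T} x * lim x) \<in> borel_measurable lborel" unfolding lim_def by measurable
    show "(\<lambda>x. indicator {0..T} x * ((f (h n) x - f 0 x) / h n)) \<in> borel_measurable lborel" for n by measurable
    show "AE x in lborel. (\<lambda>n. indicator {0..T} x * ((f (h n) x - f 0 x) / h n)) \<longlonglongrightarrow> indicator {0..T} x * lim x"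
      by (intro AE_I2 tendsto_mult tendsto_const lim)
    show "AE x in lborel. norm (indicator {0..T} x * ((f (h n) x - f 0 x) / h n)) \<le> indicator {0..T} x * w x" for n
      using bound[OF h[of n]] by (intro AE_I2) (auto simp: indicator_def)
  qed
  moreover have "0 \<le> (\<integral>x. indicator {0..T} x * ((f (h n) x - f 0 x) / h n) \<partial>lborel)" for n
  proof -
    have hn: "h n \<noteq> 0" using h(1)[of n] by simp
    \<comment> \<open>A non-integrable function has integral 0 by convention, so
      \<open>f (h n)\<close> must be shown integrable before the integral of the quotient can be
      split; integrability is recovered from the dominated quotient.\<close>
    have "set_integrable lborel {0..T} (\<lambda>x. h n * ((f (h n) x - f 0 x) / h n) + f 0 x)"
      by (intro set_integral_add(1) set_integrable_mult_right q_int f0_int h)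
    then have fh: "set_integrable lborel {0..T} (f (h n))" using hn by simp
    have "(LBINT x:{0..T}. (f (h n) x - f 0 x) / h n) = ((LBINT x:{0..T}. f (h n) x) - (LBINT x:{0..T}. f 0 x)) / h n"
      using fh f0_int by (simp add: set_integral_diff)
    moreover have "(LBINT x:{0..T}. f 0 x) \<le> (LBINT x:{0..T}. f (h n) x)"
      using ge[OF h[of n]] by (simp add: f_def)
    ultimately show ?thesis using h(1)[of n] by (simp add: set_lebesgue_integral_def)
  qed
  ultimately have "0 \<le> (\<integral>x. indicator {0..T} x * lim x \<partial>lborel)"
    by (intro LIMSEQ_le_const) auto
  then show ?thesis by (simp add: set_lebesgue_integral_def lim_def)
qed

text \<open>Positivity makes the extended graph monotone and hence single-valued, so choosing values
  gives a functional that is linear on functions bounded on \<open>S\<close>; elsewhere its values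
  are arbitrary.\<close>

lemma positive_functional_extension:
  fixes S :: "real set"
  assumes V: "pos_graph S V" and e: "(e, c) \<in> V" "\<And>x. x \<in> S \<Longrightarrow> 1 \<le> e x"
  obtains L where "positive_functional S L" "\<And>\<phi> r. (\<phi>, r) \<in> V \<Longrightarrow> bounded (\<phi> ` S) \<Longrightarrow> L \<phi> = r"
proof -
  obtain G where G: "V \<subseteq> G" "pos_graph S G"
    and ex: "\<forall>\<phi>. bounded (\<phi> ` S) \<longrightarrow> (\<exists>r. (\<phi>, r) \<in> G)"
    by (rule positive_extension[OF assms])
  define L where "L \<phi> = (SOME r. (\<phi>, r) \<in> G)" for \<phi>
  have L: "(\<phi>, L \<phi>) \<in> G" if b: "bounded (\<phi> ` S)" for \<phi>
  proof -
    have "\<exists>r. (\<phi>, r) \<in> G" using ex b by blast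
    then show ?thesis unfolding L_def by (rule someI_ex)
  qed
  have uniq: "r = s" if "(\<phi>, r) \<in> G" "(\<phi>, s) \<in> G" for \<phi> r s
    using pos_graph_mono[OF G(2) that] pos_graph_mono[OF G(2) that(2,1)] by simp
  have "positive_functional S L"
  proof
    fix \<phi> \<psi> :: "real \<Rightarrow> real" and t :: real
    assume b: "bounded (\<phi> ` S)"
    show "L (\<lambda>x. t * \<phi> x) = t * L \<phi>"
      by (rule uniq[OF L pos_graph_scale[OF G(2) L[OF b]]])
        (use bounded_scaling[OF b, of t] in \<open>simp add: image_image\<close>)
    show "0 \<le> L \<phi>" if "\<And>x. x \<in> S \<Longrightarrow> 0 \<le> \<phi> x"
      by (rule pos_graph_nonneg[OF G(2) L[OF b] that])
    assume c: "bounded (\<psi> ` S)"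
    show "L (\<lambda>x. \<phi> x + \<psi> x) = L \<phi> + L \<psi>"
      by (rule uniq[OF L pos_graph_add[OF G(2) L[OF b] L[OF c]]]) (rule bounded_plus_comp[OF b c])
  qed
  moreover have "L \<phi> = r" if "(\<phi>, r) \<in> V" "bounded (\<phi> ` S)" for \<phi> r
    using uniq[OF L[OF that(2)]] that(1) G(1) by blast
  ultimately show thesis by (rule that)
qed

section \<open>Weak derivatives\<close>

definition square_int :: "real \<Rightarrow> (real \<Rightarrow> real) \<Rightarrow> bool" where
  "square_int T z \<longleftrightarrow> z \<in> borel_measurable borel \<and> set_integrable lborel {0..T} (\<lambda>x. (z x)\<^sup>2)"

definition prim :: "(real \<Rightarrow> real) \<Rightarrow> real \<Rightarrow> real" where
  "prim z x = (LBINT t:{0..x}. z t)"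

lemma square_int_meas: "square_int T z \<Longrightarrow> z \<in> borel_measurable borel"
  by (simp add: square_int_def)

lemma set_integrable_bounded:
  fixes f :: "real \<Rightarrow> real"
  assumes "set_borel_measurable lborel {p..q} f" "\<And>x. x \<in> {p..q} \<Longrightarrow> \<bar>f x\<bar> \<le> B"
  shows "set_integrable lborel {p..q} f"
proof (rule set_integrable_bound[OF _ assms(1)])
  show "set_integrable lborel {p..q} (\<lambda>x. B)" by (simp add: set_integrable_def emeasure_lborel_Icc_eq)
  show "AE x in lborel. x \<in> {p..q} \<longrightarrow> norm (f x) \<le> norm B"
    using assms(2) by (intro AE_I2) force
qed

lemma square_int_mult:
  assumes "square_int T g" "square_int T z"
  shows "set_integrable lborel {0..T} (\<lambda>x. g x * z x)"
proof (rule set_integrable_bound)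
  note [measurable] = square_int_meas[OF assms(1)] square_int_meas[OF assms(2)]
  show "set_integrable lborel {0..T} (\<lambda>x. (g x)\<^sup>2 + (z x)\<^sup>2)"
    using assms by (intro set_integral_add(1)) (auto simp: square_int_def)
  show "set_borel_measurable lborel {0..T} (\<lambda>x. g x * z x)"
    unfolding set_borel_measurable_def by measurable
  have "\<bar>g x * z x\<bar> \<le> (g x)\<^sup>2 + (z x)\<^sup>2" for x
    using sum_squares_bound[of "\<bar>g x\<bar>" "\<bar>z x\<bar>"] abs_ge_zero[of "g x * z x"] unfolding abs_mult power2_abs by linarith
  then show "AE x in lborel. x \<in> {0..T} \<longrightarrow> norm (g x * z x) \<le> norm ((g x)\<^sup>2 + (z x)\<^sup>2)"
    by (intro AE_I2) simp
qed

lemma square_int_bounded: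
  assumes "z \<in> borel_measurable borel" "\<And>x. x \<in> {0..T} \<Longrightarrow> \<bar>z x\<bar> \<le> B"
  shows "square_int T z"
  unfolding square_int_def
proof
  note [measurable] = assms(1)
  show "set_integrable lborel {0..T} (\<lambda>x. (z x)\<^sup>2)"
  proof (rule set_integrable_bounded)
    show "set_borel_measurable lborel {0..T} (\<lambda>x. (z x)\<^sup>2)"
      unfolding set_borel_measurable_def by measurable
    show "\<bar>(z x)\<^sup>2\<bar> \<le> B\<^sup>2" if "x \<in> {0..T}" for x
      using power_mono[OF assms(2)[OF that], of 2] by simp
  qed
qed (fact assms)

lemma square_int_imp_integrable:
  assumes "square_int T z"
  shows "set_integrable lborel {0..T} z"
  using square_int_mult[OF assms square_int_bounded[of "\<lambda>x. 1" T 1]] by simp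

lemma square_int_add:
  assumes "square_int T g" "square_int T z"
  shows "square_int T (\<lambda>x. g x + t * z x)"
proof -
  note [measurable] = square_int_meas[OF assms(1)] square_int_meas[OF assms(2)]
  have "set_integrable lborel {0..T} (\<lambda>x. ((g x)\<^sup>2 + (2 * t) * (g x * z x)) + t\<^sup>2 * (z x)\<^sup>2)"
    using assms by (intro set_integral_add(1) set_integrable_mult_right square_int_mult) (auto simp: square_int_def)
  moreover have "((g x)\<^sup>2 + (2 * t) * (g x * z x)) + t\<^sup>2 * (z x)\<^sup>2 = (g x + t * z x)\<^sup>2" for x
    by (simp add: power2_eq_square algebra_simps)
  ultimately show ?thesis by (simp add: square_int_def)
qed

lemma prim_eq_integral:
  assumes "set_integrable lborel {0..T} z" "x \<in> {0..T}"
  shows "prim z x = integral {0..x} z"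
  unfolding prim_def using assms
  by (intro set_borel_integral_eq_integral(2) set_integrable_subset[OF assms(1)]) auto

lemma continuous_on_prim:
  assumes "set_integrable lborel {0..T} z"
  shows "continuous_on {0..T} (prim z)"
proof -
  have "continuous_on {0..T} (\<lambda>x. integral {0..x} z)"
    by (rule indefinite_integral_continuous_1[OF set_borel_integral_eq_integral(1)[OF assms]])
  then show ?thesis by (rule continuous_on_eq) (use prim_eq_integral[OF assms] in auto)
qed

lemma prim_0 [simp]: "prim z 0 = 0"
proof -
  have "prim z 0 = (LBINT t:{0}. z t)" by (simp add: prim_def)
  also have "\<dots> = (LBINT t:{}. z t)"
    by (rule set_integral_discrete_difference[where X="{0}"]) auto
  also have "\<dots> = 0" by (simp add: set_lebesgue_integral_def)
  finally show ?thesis .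
qed

lemma prim_add:
  assumes "set_integrable lborel {0..T} z" "set_integrable lborel {0..T} z'" "x \<in> {0..T}"
  shows "prim (\<lambda>x. z x + t * z' x) x = prim z x + t * prim z' x"
proof -
  have "set_integrable lborel {0..x} z" "set_integrable lborel {0..x} z'"
    using assms by (auto intro: set_integrable_subset[OF assms(1)] set_integrable_subset[OF assms(2)])
  then show ?thesis unfolding prim_def by (subst set_integral_add(2)) auto
qed

lemma weak_deriv_on_prim:
  "weak_deriv_on T u g \<longleftrightarrow> g \<in> borel_measurable borel \<and> set_integrable lborel {0..T} g \<and>
     (\<forall>x\<in>{0..T}. u x = u 0 + prim g x)"
  by (simp add: weak_deriv_on_def prim_def)

lemma weak_derivD:
  assumes "weak_deriv_on T u g"
  shows "g \<in> borel_measurable borel" "set_integrable lborel {0..T} g"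
    "x \<in> {0..T} \<Longrightarrow> u x = u 0 + prim g x"
  using assms unfolding weak_deriv_on_prim by blast+

lemma weak_deriv_continuous:
  assumes "weak_deriv_on T u g"
  shows "continuous_on {0..T} u"
proof -
  have "continuous_on {0..T} (\<lambda>x. u 0 + prim g x)"
    by (intro continuous_intros continuous_on_prim weak_derivD[OF assms])
  then show ?thesis
    by (rule continuous_on_eq) (rule weak_derivD(3)[OF assms, symmetric])
qed

lemma weak_deriv_add_prim:
  assumes "weak_deriv_on T u g" "z \<in> borel_measurable borel" "set_integrable lborel {0..T} z"
  shows "weak_deriv_on T (\<lambda>x. u x + t * prim z x) (\<lambda>x. g x + t * z x)"
  unfolding weak_deriv_on_prim
proof (intro conjI ballI)
  note u = weak_derivD[OF assms(1)]
  note [measurable] = u(1) assms(2)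
  show "(\<lambda>x. g x + t * z x) \<in> borel_measurable borel" by measurable
  show "set_integrable lborel {0..T} (\<lambda>x. g x + t * z x)"
    by (intro set_integral_add(1) set_integrable_mult_right u assms)
  fix x assume x: "x \<in> {0..T}"
  show "u x + t * prim z x = u 0 + t * prim z 0 + prim (\<lambda>x. g x + t * z x) x"
    by (subst u(3)[OF x]) (use prim_add[OF u(2) assms(3) x, of t] in simp)
qed

text \<open>Both primitives equal \<open>u - u 0\<close>, so the difference, cut off outside
  \<open>{0..T}\<close>, integrates to zero over every half-line. Half-lines form an
  intersection-stable generator of the Borel sets, so all its set integrals vanish.\<close>

lemma weak_deriv_unique:
  assumes g: "weak_deriv_on T u g" and h: "weak_deriv_on T u h"
  shows "AE x in lborel. x \<in> {0..T} \<longrightarrow> g x = h x"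
proof (cases "0 \<le> T")
  case T: True
  define f where "f x = indicator {0..T} x * (g x - h x)" for x
  have int: "set_integrable lborel {0..T} (\<lambda>x. g x - h x)"
    by (intro set_integral_diff(1) weak_derivD(2)[OF g] weak_derivD(2)[OF h])
  then have f_int: "integrable lborel f" by (simp add: f_def[abs_def] set_integrable_def)
  have sub: "set_integrable lborel A f" if "A \<in> sets borel" for A
    unfolding set_integrable_def using that by (intro integrable_mult_indicator f_int) auto
  have sub_prim: "prim g x = prim h x" if "x \<in> {0..T}" for x
    using weak_derivD(3)[OF g that] weak_derivD(3)[OF h that] by simp
  have atMost: "(LBINT x:{..y}. f x) = 0" for y
  proof (cases "y < 0")
    case True
    then have "(LBINT x:{..y}. f x) = (LBINT x:{..y}. 0)"
      by (intro set_lebesgue_integral_cong) (auto simp: f_def)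
    then show ?thesis by simp
  next
    case False
    define m where "m = min y T"
    have m: "m \<in> {0..T}" using False T by (auto simp: m_def)
    have "(LBINT x:{..y}. f x) = (LBINT x:{0..m}. g x - h x)"
      unfolding set_lebesgue_integral_def f_def m_def
      by (intro Bochner_Integration.integral_cong) (auto simp: indicator_def)
    also have "\<dots> = prim g m - prim h m"
      unfolding prim_def using m
      by (intro set_integral_diff(2) set_integrable_subset[OF weak_derivD(2)[OF g]]
            set_integrable_subset[OF weak_derivD(2)[OF h]]) auto
    finally show ?thesis using sub_prim[OF m] by simp
  qed
  have total: "(LBINT x:UNIV. f x) = 0"
  proof -
    have "(LBINT x:UNIV. f x) = (LBINT x:{..T}. f x)"
      unfolding set_lebesgue_integral_def f_def by (intro Bochner_Integration.integral_cong) (auto simp: indicator_def)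
    then show ?thesis by (simp add: atMost)
  qed
  have "AE x in lborel. f x = 0"
  proof (rule density_unique_real[OF f_int, of "\<lambda>x. 0"])
    fix A :: "real set" assume "A \<in> sets lborel"
    then have A: "A \<in> sigma_sets UNIV (range (\<lambda>x. {..x}))"
      by (simp add: borel_eq_atMost)
    have "Int_stable (range (\<lambda>x::real. {..x}))" by (auto simp: Int_stable_def)
    moreover have "range (\<lambda>x::real. {..x}) \<subseteq> Pow UNIV" by simp
    moreover note A
    ultimately show "(LBINT x:A. f x) = (LBINT x:A. 0)"
      unfolding set_lebesgue_integral_zero
    proof (induction rule: sigma_sets_induct_disjoint)
      case (basic A)
      then show ?case using atMost by auto
    next
      case empty
      show ?case by (simp add: set_lebesgue_integral_def)
    next
      case (compl A)
      then have A: "A \<in> sets borel" by (simp add: borel_eq_atMost)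
      have "(LBINT x:A \<union> (UNIV - A). f x) = (LBINT x:A. f x) + (LBINT x:UNIV - A. f x)"
        using A by (intro set_integral_Un sub) auto
      then show ?case using compl total by simp
    next
      case (union A)
      then have A: "\<And>i. A i \<in> sets borel" by (auto simp: borel_eq_atMost)
      have "(LBINT x:(\<Union>i. A i). f x) = (\<Sum>i. (LBINT x:(A i). f x))"
        using A union(1) by (intro lebesgue_integral_countable_add sub) (auto simp: disjoint_family_on_def)
      then show ?case using union by simp
    qed
  qed simp
  then show ?thesis by eventually_elim (auto simp: f_def)
qed auto

text \<open>\<open>wderiv\<close> is an unspecified choice; by uniqueness almost everywhere any
  known weak derivative may replace it. This gives access to the energy of a perturbed
  function.\<close>

lemma Ffun_eq:
  assumes w: "weak_deriv_on T w g" and a: "continuous_on UNIV a" and b: "continuous_on UNIV b"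
  shows "Ffun a b T w = (LBINT x:{0..T}. a (w x) * (g x)\<^sup>2 + b (w x))"
proof -
  have w': "weak_deriv_on T w (wderiv T w)" unfolding wderiv_def by (rule someI[of _ g]) (rule w)
  have meas: "(\<lambda>x. indicator {0..T} x *\<^sub>R (a (w x) * (h x)\<^sup>2 + b (w x))) \<in> borel_measurable lborel"
    if "weak_deriv_on T w h" for h
  proof -
    have [measurable]: "h \<in> borel_measurable borel" using that by (simp add: weak_deriv_on_def)
    have cw: "continuous_on {0..T} (\<lambda>x. c (w x))" if "continuous_on UNIV c" for c :: "real \<Rightarrow> real"
      using continuous_on_compose2[OF that weak_deriv_continuous[OF w]] by auto
    have [measurable]: "(\<lambda>x. indicator {0..T} x *\<^sub>R a (w x)) \<in> borel_measurable borel"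
      "(\<lambda>x. indicator {0..T} x *\<^sub>R b (w x)) \<in> borel_measurable borel"
      by (rule borel_measurable_continuous_on_indicator[OF _ cw[OF a]]
          borel_measurable_continuous_on_indicator[OF _ cw[OF b]]; simp)+
    have "(\<lambda>x. (indicator {0..T} x *\<^sub>R a (w x)) * (h x)\<^sup>2 + indicator {0..T} x *\<^sub>R b (w x)) \<in> borel_measurable borel"
      by measurable
    then show ?thesis by (simp add: algebra_simps)
  qed
  show ?thesis
    unfolding Ffun_def set_lebesgue_integral_def
    by (rule integral_cong_AE[OF meas[OF w'] meas[OF w]])
      (use weak_deriv_unique[OF w' w] in eventually_elim, auto simp: indicator_def)
qed

section \<open>The moving-window operator \<open>Bop\<close>\<close>

lemma Bop_eq:
  assumes v: "continuous_on {0..T} v" and x: "x \<in> {0..T-1}"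
  shows "Bop v x = integral {0..x+1} v - integral {0..x} v"
proof -
  have c: "continuous_on {x..x+1} v" by (rule continuous_on_subset[OF v]) (use x in auto)
  have "Bop v x = integral {x..x+1} v"
    unfolding Bop_def by (intro set_borel_integral_eq_integral(2) borel_integrable_atLeastAtMost' c)
  moreover have "integral {0..x} v + integral {x..x+1} v = integral {0..x+1} v"
    using x by (intro Henstock_Kurzweil_Integration.integral_combine integrable_continuous_real
        continuous_on_subset[OF v]) auto
  ultimately show ?thesis by simp
qed

lemma Bop_has_real_derivative:
  assumes v: "continuous_on {0..T} v" and x: "x \<in> {0..T-1}"
  shows "(Bop v has_real_derivative v (x + 1) - v x) (at x within {0..T-1})"
proof -
  define W where "W y = integral {0..y} v" for y
  have W: "(W has_real_derivative v y) (at y within {0..T})" if "y \<in> {0..T}" for y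
    unfolding W_def by (rule integral_has_real_derivative[OF v that])
  have "(W \<circ> (\<lambda>x. x + 1) has_real_derivative v (x + 1) * 1) (at x within {0..T-1})"
  proof (rule DERIV_image_chain)
    show "(W has_real_derivative v (x + 1)) (at (x + 1) within (\<lambda>x. x + 1) ` {0..T - 1})"
      by (rule DERIV_subset[OF W]) (use x in auto)
    show "((\<lambda>x. x + 1) has_real_derivative 1) (at x within {0..T - 1})"
      by (auto intro!: derivative_eq_intros)
  qed
  moreover have "(W has_real_derivative v x) (at x within {0..T-1})"
    by (rule DERIV_subset[OF W]) (use x in auto)
  ultimately have "((\<lambda>x. W (x + 1) - W x) has_real_derivative v (x + 1) - v x) (at x within {0..T-1})"
    by (auto intro!: derivative_eq_intros simp: o_def)
  then show ?thesis
    by (rule has_field_derivative_transform_within[OF _ zero_less_one x]) (simp add: W_def Bop_eq[OF v])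
qed

lemma continuous_on_Bop:
  "continuous_on {0..T} v \<Longrightarrow> continuous_on {0..T-1} (Bop v)"
  by (rule DERIV_continuous_on) (rule Bop_has_real_derivative)

lemma Bop_add:
  assumes v: "continuous_on {0..T} v" and w: "continuous_on {0..T} w" and x: "x \<in> {0..T-1}"
  shows "Bop (\<lambda>x. v x + t * w x) x = Bop v x + t * Bop w x"
proof -
  have "set_integrable lborel {x..x+1} v" "set_integrable lborel {x..x+1} w"
    using x by (auto intro!: borel_integrable_atLeastAtMost' continuous_on_subset[OF v] continuous_on_subset[OF w])
  then show ?thesis unfolding Bop_def by (subst set_integral_add(2)) auto
qed

section \<open>The multiplier\<close>

locale obstacle_minimizer =
  fixes T La Lb :: real and a b u :: "real \<Rightarrow> real"
  assumes T: "T > 1"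
    and a_C1: "a C1_differentiable_on UNIV" and b_C1: "b C1_differentiable_on UNIV"
    and a_lip: "La-lipschitz_on UNIV a" and b_lip: "Lb-lipschitz_on UNIV b"
    and uK: "u \<in> Kset T"
    and umin: "\<And>w. w \<in> Kset T \<Longrightarrow> Ffun a b T u \<le> Ffun a b T w"
begin

definition g where "g = wderiv T u"

text \<open>The hypotheses say nothing about \<open>u\<close> outside \<open>[0,T]\<close>; clamping the argument makes the
coefficients \<open>a \<circ> u\<close> etc. Borel on the whole line.\<close>

definition ub where "ub x = u (max 0 (min T x))"

text \<open>\<open>p\<close> and \<open>q\<close> are the partial derivatives of the integrand with
  respect to u' and u, so that the first variation in direction v is the integral of p v' + q
  v.\<close>

definition p where "p x = 2 * a (ub x) * g x"

definition q where "q x = deriv a (ub x) * (g x)\<^sup>2 + deriv b (ub x)"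

definition first_variation where
  "first_variation z = (LBINT x:{0..T}. p x * z x + q x * prim z x)"

text \<open>Test functions are parametrised by their derivatives: \<open>test z\<close> means \<open>prim z \<in> H\<^sup>1\<^sub>0(0,T)\<close>.\<close>

definition test where "test z \<longleftrightarrow> square_int T z \<and> prim z T = 0"

lemma H1_shift: "weak_deriv_on T (\<lambda>x. w x - c) h \<longleftrightarrow> weak_deriv_on T w h"
  unfolding weak_deriv_on_def by (simp add: algebra_simps)

lemma minimizer_props: "weak_deriv_on T u g" "square_int T g" "u 0 = 1" "u T = 1"
    "x \<in> {0..T-1} \<Longrightarrow> 0 \<le> Bop u x"
proof -
  obtain h where h: "weak_deriv_on T u h" "set_integrable lborel {0..T} (\<lambda>x. (h x)\<^sup>2)"
    using uK by (auto simp: Kset_def Uset_def H10_def H1_def H1_shift)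
  show wd: "weak_deriv_on T u g" unfolding g_def wderiv_def by (rule someI[of _ h]) (rule h)
  note [measurable] = weak_derivD(1)[OF wd] weak_derivD(1)[OF h(1)]
  have "set_integrable lborel {0..T} (\<lambda>x. (g x)\<^sup>2)"
  proof (rule set_integrable_bound[OF h(2)])
    show "set_borel_measurable lborel {0..T} (\<lambda>x. (g x)\<^sup>2)"
      unfolding set_borel_measurable_def by measurable
    show "AE x in lborel. x \<in> {0..T} \<longrightarrow> norm ((g x)\<^sup>2) \<le> norm ((h x)\<^sup>2)"
      using weak_deriv_unique[OF wd h(1)] by eventually_elim auto
  qed
  then show "square_int T g" using weak_derivD(1)[OF wd] by (simp add: square_int_def)
  show "u 0 = 1" "u T = 1" "x \<in> {0..T-1} \<Longrightarrow> 0 \<le> Bop u x"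
    using uK by (auto simp: Kset_def Uset_def H10_def)
qed

lemma u_cont: "continuous_on {0..T} u"
  by (rule weak_deriv_continuous[OF minimizer_props(1)])

lemma prim_cont: "square_int T z \<Longrightarrow> continuous_on {0..T} (prim z)"
  by (intro continuous_on_prim square_int_imp_integrable)

lemma perturbation_in_Kset:
  assumes z: "test z" and B: "\<And>x. x \<in> {0..T-1} \<Longrightarrow> 0 \<le> Bop u x + h * Bop (prim z) x"
  shows "(\<lambda>x. u x + h * prim z x) \<in> Kset T"
    and "weak_deriv_on T (\<lambda>x. u x + h * prim z x) (\<lambda>x. g x + h * z x)"
proof -
  have sq: "square_int T z" using z by (simp add: test_def)
  show wd: "weak_deriv_on T (\<lambda>x. u x + h * prim z x) (\<lambda>x. g x + h * z x)"
    by (intro weak_deriv_add_prim minimizer_props square_int_meas[OF sq] square_int_imp_integrable[OF sq])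
  have "set_integrable lborel {0..T} (\<lambda>x. (g x + h * z x)\<^sup>2)"
    using square_int_add[OF minimizer_props(2) sq, of h] by (simp add: square_int_def)
  with wd have "H1 T (\<lambda>x. u x + h * prim z x - 1)"
    unfolding H1_def H1_shift by blast
  then show "(\<lambda>x. u x + h * prim z x) \<in> Kset T"
    using z B Bop_add[OF u_cont prim_cont[OF sq]]
    by (simp add: Kset_def Uset_def H10_def minimizer_props test_def)
qed

text \<open>Where \<open>Bop (prim z)\<close> is positive, a positive step cannot violate the
  constraint. The remaining points form a compact set disjoint from the contact set, on which
  \<open>Bop u\<close> has a positive lower bound. Hence one range of step sizes serves all
  points.\<close>

lemma variation_strict:
  assumes z: "test z" and pos: "\<And>x. x \<in> contact_set T u \<Longrightarrow> 0 < Bop (prim z) x"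
  shows "0 \<le> first_variation z"
proof -
  have sq: "square_int T z" using z by (simp add: test_def)
  let ?v = "prim z"
  have cB: "continuous_on {0..T-1} (Bop ?v)" "continuous_on {0..T-1} (Bop u)"
    by (intro continuous_on_Bop prim_cont sq u_cont)+
  obtain M where M: "\<And>x. x \<in> {0..T-1} \<Longrightarrow> \<bar>Bop ?v x\<bar> \<le> M"
    by (rule continuous_on_Icc_bounded[OF cB(1)]) blast
  have M0: "0 \<le> M" using M[of 0] T by force
  define C where "C = {0..T-1} \<inter> Bop ?v -` {..0}"
  have "compact C"
    unfolding C_def compact_eq_bounded_closed
    by (intro conjI continuous_closed_preimage cB) (auto intro: bounded_subset[OF bounded_closed_interval])
  obtain m where m: "0 < m" "\<And>x. x \<in> C \<Longrightarrow> m \<le> Bop u x"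
  proof (cases "C = {}")
    case False
    have "continuous_on C (Bop u)" by (rule continuous_on_subset[OF cB(2)]) (auto simp: C_def)
    then obtain y where y: "y \<in> C" "\<And>x. x \<in> C \<Longrightarrow> Bop u y \<le> Bop u x"
      using continuous_attains_inf[OF \<open>compact C\<close> False] by blast
    have "0 < Bop u y"
    proof (rule ccontr)
      assume "\<not> 0 < Bop u y"
      then have "y \<in> contact_set T u" using y(1) minimizer_props(5)[of y] by (auto simp: C_def contact_set_def)
      from pos[OF this] y(1) show False by (simp add: C_def)
    qed
    with y show thesis using that by blast
  qed (use that[of 1] in auto)
  \<comment> \<open>Ensures \<open>h * \<bar>Bop ?v x\<bar> \<le> m\<close> for all steps up to
    \<open>h0\<close>; the added 1 allows \<open>M = 0\<close>.\<close>
  define h0 where "h0 = m / (M + 1)"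
  have h0: "h0 > 0" using m M0 by (simp add: h0_def)
  have nonneg: "0 \<le> Bop u x + h * Bop ?v x" if h: "0 < h" "h \<le> h0" and x: "x \<in> {0..T-1}" for h x
  proof (cases "x \<in> C")
    case True
    have "h * \<bar>Bop ?v x\<bar> \<le> h0 * M" using h M[OF x] by (intro mult_mono) auto
    also have "\<dots> \<le> h0 * (M + 1)" using h0 by simp
    also have "\<dots> = m" using M0 by (simp add: h0_def)
    also have "\<dots> \<le> Bop u x" by (rule m(2)[OF True])
    finally have "\<bar>h * Bop ?v x\<bar> \<le> Bop u x" using h by (simp add: abs_mult)
    then show ?thesis by linarith
  next
    case False
    then have "0 < Bop ?v x" using x by (auto simp: C_def)
    then show ?thesis using minimizer_props(5)[OF x] h by simp
  qed
  \<comment> \<open>Clamped arguments make \<open>u\<close> and \<open>?v\<close> Borel and bounded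
    on the line without affecting integrals over \<open>{0..T}\<close>.\<close>
  define cl where "cl x = max 0 (min T x)" for x
  have cl: "cl x \<in> {0..T}" for x using T by (auto simp: cl_def)
  have cl_id: "cl x = x" if "x \<in> {0..T}" for x using that by (auto simp: cl_def)
  have cl_cont: "continuous_on UNIV cl" unfolding cl_def by (intro continuous_intros)
  have meas: "(\<lambda>x. w (cl x)) \<in> borel_measurable borel" if "continuous_on {0..T} w" for w :: "real \<Rightarrow> real"
    by (intro borel_measurable_continuous_onI continuous_on_compose2[OF that cl_cont]) (use cl in auto)
  obtain Bu where Bu: "\<And>x. x \<in> {0..T} \<Longrightarrow> \<bar>u x\<bar> \<le> Bu"
    by (rule continuous_on_Icc_bounded[OF u_cont]) blast
  obtain Bv where Bv: "\<And>x. x \<in> {0..T} \<Longrightarrow> \<bar>?v x\<bar> \<le> Bv"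
    by (rule continuous_on_Icc_bounded[OF prim_cont[OF sq]]) blast
  have conta: "continuous_on UNIV a" and contb: "continuous_on UNIV b"
    using lipschitz_on_continuous_on a_lip b_lip by auto
  have "0 \<le> (LBINT x:{0..T}. 2 * a (u (cl x)) * g x * z x + (deriv a (u (cl x)) * (g x)\<^sup>2 + deriv b (u (cl x))) * ?v (cl x))"
  proof (rule directional_derivative_nonneg[OF a_C1 b_C1 a_lip b_lip meas[OF u_cont] meas[OF prim_cont[OF sq]] _ square_int_meas[OF sq], where B="max Bu Bv"])
    show "g \<in> borel_measurable borel" by (rule square_int_meas[OF minimizer_props(2)])
    show "\<bar>u (cl x)\<bar> \<le> max Bu Bv" "\<bar>?v (cl x)\<bar> \<le> max Bu Bv" for x
      using Bu[OF cl[of x]] Bv[OF cl[of x]] by auto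
    show "set_integrable lborel {0..T} (\<lambda>x. (g x)\<^sup>2)" "set_integrable lborel {0..T} (\<lambda>x. (z x)\<^sup>2)"
      using minimizer_props(2) sq by (auto simp: square_int_def)
    show "0 < h0" by (rule h0)
    fix h :: real assume h: "0 < h" "h \<le> h0"
    have K: "(\<lambda>x. u x + h * ?v x) \<in> Kset T" and wd: "weak_deriv_on T (\<lambda>x. u x + h * ?v x) (\<lambda>x. g x + h * z x)"
      using perturbation_in_Kset[OF z nonneg[OF h]] by auto
    have "(LBINT x:{0..T}. a (u (cl x)) * (g x)\<^sup>2 + b (u (cl x))) = Ffun a b T u"
      unfolding Ffun_eq[OF minimizer_props(1) conta contb]
      by (rule set_lebesgue_integral_cong) (auto simp: cl_id)
    also have "\<dots> \<le> Ffun a b T (\<lambda>x. u x + h * ?v x)" by (rule umin[OF K])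
    also have "\<dots> = (LBINT x:{0..T}. a (u (cl x) + h * ?v (cl x)) * (g x + h * z x)\<^sup>2 + b (u (cl x) + h * ?v (cl x)))"
      unfolding Ffun_eq[OF wd conta contb]
      by (rule set_lebesgue_integral_cong) (auto simp: cl_id)
    finally show "(LBINT x:{0..T}. a (u (cl x)) * (g x)\<^sup>2 + b (u (cl x))) \<le>
      (LBINT x:{0..T}. a (u (cl x) + h * ?v (cl x)) * (g x + h * z x)\<^sup>2 + b (u (cl x) + h * ?v (cl x)))" .
  qed
  also have "\<dots> = first_variation z"
    unfolding first_variation_def p_def q_def ub_def cl_def[symmetric]
    by (rule set_lebesgue_integral_cong) (auto simp: cl_id)
  finally show ?thesis .
qed

end

section \<open>A strictly feasible direction, the adjoint of \<open>Bop\<close>, and integration by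
  parts\<close>

lemma set_integrable_mult_continuous:
  fixes v q :: "real \<Rightarrow> real"
  assumes q: "set_integrable lborel {c..d} q" and v: "continuous_on {c..d} v"
  shows "set_integrable lborel {c..d} (\<lambda>x. q x * v x)"
proof -
  obtain B where B: "\<And>x. x \<in> {c..d} \<Longrightarrow> \<bar>v x\<bar> \<le> B"
    by (rule continuous_on_Icc_bounded[OF v]) blast
  show ?thesis
  proof (rule set_integrable_bound)
    show "set_integrable lborel {c..d} (\<lambda>x. B * q x)" using q by (rule set_integrable_mult_right)
    have [measurable]: "(\<lambda>x. indicator {c..d} x *\<^sub>R v x) \<in> borel_measurable borel"
      by (rule borel_measurable_continuous_on_indicator[OF _ v]) simp
    have [measurable]: "(\<lambda>x. indicator {c..d} x *\<^sub>R q x) \<in> borel_measurable borel"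
      using borel_measurable_integrable[OF q[unfolded set_integrable_def]] by simp
    have "(\<lambda>x. (indicator {c..d} x *\<^sub>R q x) * (indicator {c..d} x *\<^sub>R v x)) \<in> borel_measurable borel"
      by measurable
    also have "(\<lambda>x. (indicator {c..d} x *\<^sub>R q x) * (indicator {c..d} x *\<^sub>R v x)) = (\<lambda>x. indicator {c..d} x *\<^sub>R (q x * v x))"
      by (auto simp: indicator_def)
    finally show "set_borel_measurable lborel {c..d} (\<lambda>x. q x * v x)"
      by (simp add: set_borel_measurable_def)
    have "\<bar>q x * v x\<bar> \<le> \<bar>B * q x\<bar>" if "x \<in> {c..d}" for x
      using mult_right_mono[OF order_trans[OF B[OF that] abs_ge_self], of "\<bar>q x\<bar>"]
      by (simp add: abs_mult mult.commute)
    then show "AE x in lborel. x \<in> {c..d} \<longrightarrow> norm (q x * v x) \<le> norm (B * q x)"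
      by (intro AE_I2) simp
  qed
qed

lemma prim_quadratic:
  assumes "x \<in> {0..T}"
  shows "prim (\<lambda>x. T - 2 * x) x = T * x - x\<^sup>2"
proof -
  have "((\<lambda>x. T - 2 * x) has_integral (T * x - x\<^sup>2) - (T * 0 - 0\<^sup>2)) {0..x}"
    using assms by (intro fundamental_theorem_of_calculus)
      (auto intro!: derivative_eq_intros simp flip: has_real_derivative_iff_has_vector_derivative)
  moreover have "prim (\<lambda>x. T - 2 * x) x = integral {0..x} (\<lambda>x. T - 2 * x)"
    by (intro prim_eq_integral[OF _ assms] borel_integrable_atLeastAtMost' continuous_intros)
  ultimately show ?thesis by (simp add: integral_unique)
qed

text \<open>The integral of \<open>t * (T - t)\<close> over the window is exactly
  \<open>x * (T - 1 - x) + T / 2 - 1 / 3\<close>. The product is nonnegative on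
  \<open>{0..T-1}\<close>, and \<open>T > 1\<close> leaves \<open>1 / 2 - 1 / 3\<close>.\<close>

lemma Bop_prim_quadratic:
  assumes "T > 1" and x: "x \<in> {0..T-1}"
  shows "1 / 6 \<le> Bop (prim (\<lambda>x. T - 2 * x)) x"
proof -
  have "Bop (prim (\<lambda>x. T - 2 * x)) x = (LBINT t:{x..x+1}. T * t - t\<^sup>2)"
    unfolding Bop_def using x by (intro set_lebesgue_integral_cong) (auto intro!: prim_quadratic)
  also have "\<dots> = integral {x..x+1} (\<lambda>t. T * t - t\<^sup>2)"
    by (intro set_borel_integral_eq_integral(2) borel_integrable_atLeastAtMost' continuous_intros)
  also have "\<dots> = (T * (x + 1)\<^sup>2 / 2 - (x + 1) ^ 3 / 3) - (T * x\<^sup>2 / 2 - x ^ 3 / 3)"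
    by (intro integral_unique fundamental_theorem_of_calculus)
      (auto intro!: derivative_eq_intros simp flip: has_real_derivative_iff_has_vector_derivative)
  also have "\<dots> = x * (T - 1 - x) + T / 2 - 1 / 3"
    by (simp add: power2_eq_square power3_eq_cube field_simps)
  finally have "Bop (prim (\<lambda>x. T - 2 * x)) x = x * (T - 1 - x) + T / 2 - 1 / 3" .
  moreover have "0 \<le> x * (T - 1 - x)" using x by simp
  ultimately show ?thesis using assms(1) by linarith
qed

text \<open>Substituting \<open>t = s + 1\<close> in the term with \<open>v (s + 1)\<close> moves
  the translation onto \<open>\<Phi>\<close>. Since \<open>\<Phi>\<close> vanishes on negative
  arguments, the shifted integral may start at 0 instead of 1; since \<open>\<Phi>\<close> is
  constant from \<open>N\<close> on, the boundary term is its integral against \<open>v\<close> over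
  \<open>{N<..N+1}\<close>.\<close>

lemma Bop_adjoint:
  fixes \<Phi> v :: "real \<Rightarrow> real"
  assumes N: "0 \<le> N" and mono: "mono \<Phi>" and neg: "\<And>s. s < 0 \<Longrightarrow> \<Phi> s = 0"
    and const: "\<And>s. N \<le> s \<Longrightarrow> \<Phi> s = \<Phi> N" and v: "continuous_on {0..N+1} v"
  shows "Bop v N * \<Phi> N - (LBINT s:{0..N}. (v (s + 1) - v s) * \<Phi> s)
     = (LBINT t:{0..N+1}. (\<Phi> t - \<Phi> (t - 1)) * v t)"
proof -
  have [measurable]: "\<Phi> \<in> borel_measurable borel" by (rule borel_measurable_mono[OF mono])
  have \<Phi>0: "0 \<le> \<Phi> s" for s using monoD[OF mono, of "min s (-1)" s] neg[of "min s (-1)"] by simp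
  have \<Phi>N: "\<Phi> s \<le> \<Phi> N" for s using monoD[OF mono, of s "max s N"] const[of "max s N"] by simp
  have \<Phi>_int: "set_integrable lborel {c..d} \<Phi>" "set_integrable lborel {c..d} (\<lambda>t. \<Phi> (t - 1))" for c d
    using \<Phi>0 \<Phi>N by (auto intro!: set_integrable_bounded[of _ _ _ "\<Phi> N"] simp: set_borel_measurable_def)
  have int: "set_integrable lborel {c..d} (\<lambda>t. \<Phi> t * w t)" "set_integrable lborel {c..d} (\<lambda>t. \<Phi> (t - 1) * w t)"
    if "continuous_on {c..d} w" for c d w
    by (intro set_integrable_mult_continuous \<Phi>_int that)+
  have v1: "continuous_on {0..N} (\<lambda>s. v (s + 1))"
    by (intro continuous_on_compose2[OF v] continuous_intros) auto
  have vN: "continuous_on {0..N} v" by (rule continuous_on_subset[OF v]) auto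
  have "(LBINT s:{0..N}. (v (s + 1) - v s) * \<Phi> s) = (LBINT s:{0..N}. \<Phi> s * v (s + 1)) - (LBINT s:{0..N}. \<Phi> s * v s)"
    using int(1)[OF v1] int(1)[OF vN] by (subst set_integral_diff(2)[symmetric]) (auto simp: algebra_simps)
  also have "(LBINT s:{0..N}. \<Phi> s * v (s + 1)) = (LBINT t:{0..N+1}. \<Phi> (t - 1) * v t)"
  proof -
    have "(LBINT t:{0..N+1}. \<Phi> (t - 1) * v t) = (\<integral>t. indicator {0..N} (t - 1) * (\<Phi> (t - 1) * v t) \<partial>lborel)"
      unfolding set_lebesgue_integral_def
      by (intro Bochner_Integration.integral_cong) (auto simp: indicator_def neg)
    also have "\<dots> = (\<integral>s. indicator {0..N} s * (\<Phi> s * v (s + 1)) \<partial>lborel)"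
      by (subst lborel_integral_real_affine[of 1 _ 1]) (auto simp: add.commute)
    finally show ?thesis by (simp add: set_lebesgue_integral_def)
  qed
  also have "(LBINT s:{0..N}. \<Phi> s * v s) = (LBINT s:{0..N+1}. \<Phi> s * v s) - \<Phi> N * Bop v N"
  proof -
    have c: "continuous_on {N..N+1} v" by (rule continuous_on_subset[OF v]) (use N in auto)
    have "(LBINT s:{0..N+1}. \<Phi> s * v s) = (LBINT s:{0..N} \<union> {N<..N+1}. \<Phi> s * v s)"
      using N by (intro arg_cong[where f="\<lambda>A. set_lebesgue_integral lborel A _"]) auto
    also have "\<dots> = (LBINT s:{0..N}. \<Phi> s * v s) + (LBINT s:{N<..N+1}. \<Phi> s * v s)"
      using N by (intro set_integral_Un set_integrable_subset[OF int(1)[OF v]]) auto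
    also have "(LBINT s:{N<..N+1}. \<Phi> s * v s) = (LBINT s:{N..N+1}. \<Phi> s * v s)"
      by (rule set_integral_discrete_difference[where X="{N}"]) auto
    also have "\<dots> = (LBINT s:{N..N+1}. \<Phi> N * v s)"
    proof (intro set_lebesgue_integral_cong allI impI)
      fix s assume "s \<in> {N..N+1}"
      then show "\<Phi> s * v s = \<Phi> N * v s" using const[of s] by simp
    qed simp
    also have "\<dots> = \<Phi> N * Bop v N" by (simp add: Bop_def)
    finally show ?thesis by simp
  qed
  finally have "(LBINT s:{0..N}. (v (s + 1) - v s) * \<Phi> s) = (LBINT t:{0..N+1}. \<Phi> (t - 1) * v t)
     - ((LBINT s:{0..N+1}. \<Phi> s * v s) - \<Phi> N * Bop v N)" .
  moreover have "(LBINT t:{0..N+1}. (\<Phi> t - \<Phi> (t - 1)) * v t)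
      = (LBINT s:{0..N+1}. \<Phi> s * v s) - (LBINT t:{0..N+1}. \<Phi> (t - 1) * v t)"
    unfolding left_diff_distrib by (rule set_integral_diff(2)[OF int[OF v]])
  ultimately show ?thesis by simp
qed

text \<open>Fubini on the triangle \<open>0 \<le> t \<le> x \<le> T\<close>, which handles merely
  integrable \<open>r\<close> and \<open>z\<close> without differentiating their primitives
  pointwise.\<close>

lemma prim_integration_by_parts:
  assumes "0 \<le> T" and r: "set_integrable lborel {0..T} r" and z: "set_integrable lborel {0..T} z"
  shows "(LBINT x:{0..T}. r x * prim z x) = prim r T * prim z T - (LBINT x:{0..T}. prim r x * z x)"
proof -
  define R where "R x = indicator {0..T} x * r x" for x
  define Z where "Z x = indicator {0..T} x * z x" for x
  have R: "integrable lborel R" and Z: "integrable lborel Z"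
    using r z by (auto simp: R_def[abs_def] Z_def[abs_def] set_integrable_def)
  note [measurable] = borel_measurable_integrable[OF R] borel_measurable_integrable[OF Z]
  have RZ: "integrable (lborel \<Otimes>\<^sub>M lborel) (\<lambda>(x, t). R x * Z t)"
    by (intro lborel_pair.Fubini_integrable) (use R Z in \<open>auto simp: abs_mult intro!: integrable_mult_left integrable_mult_right integrable_abs\<close>)
  define f where "f = (\<lambda>(x, t). indicator {0..x} t * (R x * Z t))"
  have [measurable]: "f \<in> borel_measurable (lborel \<Otimes>\<^sub>M lborel)"
  proof -
    have "f = (\<lambda>(x, t). indicator {(x, t). 0 \<le> t \<and> t \<le> x} (x, t) * (R x * Z t))"
      by (auto simp: f_def indicator_def)
    also have "\<dots> \<in> borel_measurable (lborel \<Otimes>\<^sub>M lborel)" by measurable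
    finally show ?thesis .
  qed
  have f_int: "integrable (lborel \<Otimes>\<^sub>M lborel) f"
    by (rule Bochner_Integration.integrable_bound[OF RZ]) (auto simp: f_def indicator_def)
  have prim_z: "prim z x = (\<integral>t. indicator {0..x} t * Z t \<partial>lborel)" if "x \<in> {0..T}" for x
    unfolding prim_def set_lebesgue_integral_def Z_def
    by (intro Bochner_Integration.integral_cong) (use that in \<open>auto simp: indicator_def\<close>)
  have "(\<integral>x. (\<integral>t. f (x, t) \<partial>lborel) \<partial>lborel) = (LBINT x:{0..T}. r x * prim z x)"
    unfolding set_lebesgue_integral_def
    by (intro Bochner_Integration.integral_cong)
      (auto simp: f_def R_def prim_z mult.left_commute[of "indicator _ _"] split: split_indicator)
  moreover have "(\<integral>t. (\<integral>x. f (x, t) \<partial>lborel) \<partial>lborel) = (LBINT t:{0..T}. z t * (prim r T - prim r t))"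
    unfolding set_lebesgue_integral_def
  proof (intro Bochner_Integration.integral_cong refl)
    fix t :: real
    show "(\<integral>x. f (x, t) \<partial>lborel) = indicat_real {0..T} t *\<^sub>R (z t * (prim r T - prim r t))"
    proof (cases "t \<in> {0..T}")
      case True
      have "(LBINT x:{0..T}. r x) = (LBINT x:{0..t} \<union> {t<..T}. r x)"
        using True by (intro arg_cong[where f="\<lambda>A. set_lebesgue_integral lborel A _"]) auto
      also have "\<dots> = (LBINT x:{0..t}. r x) + (LBINT x:{t<..T}. r x)"
        using True by (intro set_integral_Un set_integrable_subset[OF r]) auto
      also have "(LBINT x:{t<..T}. r x) = (LBINT x:{t..T}. r x)"
        by (rule set_integral_discrete_difference[where X="{t}"]) auto
      finally have eq: "(LBINT x:{t..T}. r x) = prim r T - prim r t" by (simp add: prim_def)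
      have "(\<integral>x. f (x, t) \<partial>lborel) = (\<integral>x. z t * (indicator {t..T} x *\<^sub>R r x) \<partial>lborel)"
        using True by (intro Bochner_Integration.integral_cong) (auto simp: f_def R_def Z_def split: split_indicator)
      also have "\<dots> = z t * (LBINT x:{t..T}. r x)" by (simp add: set_lebesgue_integral_def)
      finally show ?thesis using True eq by simp
    qed (simp add: f_def Z_def)
  qed
  moreover have "(\<integral>x. (\<integral>t. f (x, t) \<partial>lborel) \<partial>lborel) = (\<integral>t. (\<integral>x. f (x, t) \<partial>lborel) \<partial>lborel)"
    using lborel_pair.Fubini_integral[of "\<lambda>x t. f (x, t)"] f_int by simp
  moreover have "(LBINT t:{0..T}. z t * (prim r T - prim r t)) = prim r T * prim z T - (LBINT t:{0..T}. prim r t * z t)"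
  proof -
    have "set_integrable lborel {0..T} (\<lambda>t. z t * prim r t)"
      by (rule set_integrable_mult_continuous[OF z continuous_on_prim[OF r]])
    then have "(LBINT t:{0..T}. prim r T * z t - prim r t * z t) = prim r T * (LBINT t:{0..T}. z t) - (LBINT t:{0..T}. prim r t * z t)"
      using z by (subst set_integral_diff(2)) (auto simp: mult.commute)
    then show ?thesis by (simp add: prim_def algebra_simps)
  qed
  ultimately show ?thesis by simp
qed

section \<open>The multiplier and the integrated Euler-Lagrange equation\<close>

context obstacle_minimizer
begin

lemma ub_eq: "x \<in> {0..T} \<Longrightarrow> ub x = u x"
  by (auto simp: ub_def)

lemma ub_cont: "continuous_on UNIV ub"
  unfolding ub_def
  by (intro continuous_on_compose2[OF u_cont] continuous_intros) (use T in auto)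

lemma ub_bounded: "\<exists>B. \<forall>x. \<bar>ub x\<bar> \<le> B"
proof -
  obtain B where B: "\<And>x. x \<in> {0..T} \<Longrightarrow> \<bar>u x\<bar> \<le> B"
    by (rule continuous_on_Icc_bounded[OF u_cont]) blast
  have "\<bar>ub x\<bar> \<le> B" for x unfolding ub_def using T by (intro B) auto
  then show ?thesis by blast
qed

lemma ub_compose:
  fixes c :: "real \<Rightarrow> real"
  assumes "continuous_on UNIV c"
  shows "continuous_on UNIV (\<lambda>x. c (ub x))" and "\<exists>C. \<forall>x. \<bar>c (ub x)\<bar> \<le> C"
proof -
  show "continuous_on UNIV (\<lambda>x. c (ub x))"
    by (intro continuous_on_compose2[OF assms ub_cont]) auto
  obtain B where B: "\<And>x. \<bar>ub x\<bar> \<le> B" using ub_bounded by blast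
  have "bounded (c ` {-B..B})"
    by (intro compact_imp_bounded compact_continuous_image continuous_on_subset[OF assms]) auto
  then obtain C where "\<And>y. y \<in> {-B..B} \<Longrightarrow> \<bar>c y\<bar> \<le> C"
    by (auto simp: bounded_iff simp del: atLeastAtMost_iff)
  moreover have "ub x \<in> {-B..B}" for x using B[of x] by auto
  ultimately show "\<exists>C. \<forall>x. \<bar>c (ub x)\<bar> \<le> C" by blast
qed

lemma coefficients_continuous: "continuous_on UNIV a" "continuous_on UNIV (deriv a)" "continuous_on UNIV (deriv b)"
  using a_lip lipschitz_on_continuous_on C1_UNIV_derivD(2)[OF a_C1] C1_UNIV_derivD(2)[OF b_C1] by auto

lemma ub_compose_measurable [measurable]:
  "(\<lambda>x. a (ub x)) \<in> borel_measurable borel"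
  "(\<lambda>x. deriv a (ub x)) \<in> borel_measurable borel"
  "(\<lambda>x. deriv b (ub x)) \<in> borel_measurable borel"
  by (intro borel_measurable_continuous_onI ub_compose(1) coefficients_continuous)+

lemma g_meas [measurable]: "g \<in> borel_measurable borel"
  by (rule square_int_meas[OF minimizer_props(2)])

text \<open>\<open>p\<close> becomes part of a test function's derivative in
  \<open>du_bois_reymond\<close>, which requires square integrability. For \<open>q\<close>, which
  is quadratic in the derivative, only integrability is available, so it is paired with continuous
  functions.\<close>

lemma p_square_int: "square_int T p"
  unfolding square_int_def
proof
  show p_meas [measurable]: "p \<in> borel_measurable borel" unfolding p_def by measurable
  obtain A where A: "\<And>x. \<bar>a (ub x)\<bar> \<le> A" using ub_compose(2)[OF coefficients_continuous(1)] by blast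
  show "set_integrable lborel {0..T} (\<lambda>x. (p x)\<^sup>2)"
  proof (rule set_integrable_bound)
    show "set_integrable lborel {0..T} (\<lambda>x. (4 * A\<^sup>2) * (g x)\<^sup>2)"
      using minimizer_props(2) unfolding square_int_def by (intro set_integrable_mult_right) auto
    show "set_borel_measurable lborel {0..T} (\<lambda>x. (p x)\<^sup>2)"
      unfolding set_borel_measurable_def by measurable
    have "(p x)\<^sup>2 \<le> (4 * A\<^sup>2) * (g x)\<^sup>2" for x
      using power_mono[OF A[of x] abs_ge_zero, of 2] by (simp add: p_def power_mult_distrib mult_right_mono)
    then show "AE x in lborel. x \<in> {0..T} \<longrightarrow> norm ((p x)\<^sup>2) \<le> norm ((4 * A\<^sup>2) * (g x)\<^sup>2)"
      by (intro AE_I2) simp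
  qed
qed

lemma q_integrable: "set_integrable lborel {0..T} q"
proof -
  obtain A where A: "\<And>x. \<bar>deriv a (ub x)\<bar> \<le> A" using ub_compose(2)[OF coefficients_continuous(2)] by blast
  obtain B where B: "\<And>x. \<bar>deriv b (ub x)\<bar> \<le> B" using ub_compose(2)[OF coefficients_continuous(3)] by blast
  show ?thesis
  proof (rule set_integrable_bound)
    have "set_integrable lborel {0..T} (\<lambda>x. B)" by (simp add: set_integrable_def emeasure_lborel_Icc_eq)
    then show "set_integrable lborel {0..T} (\<lambda>x. A * (g x)\<^sup>2 + B)"
      using minimizer_props(2) unfolding square_int_def by (intro set_integral_add(1) set_integrable_mult_right) auto
    show "set_borel_measurable lborel {0..T} q"
      unfolding set_borel_measurable_def q_def by measurable
    have "\<bar>q x\<bar> \<le> A * (g x)\<^sup>2 + B" for x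
    proof -
      have "\<bar>deriv a (ub x) * (g x)\<^sup>2\<bar> \<le> A * (g x)\<^sup>2"
        using A[of x] by (simp add: abs_mult mult_right_mono)
      then show ?thesis using B[of x] unfolding q_def by linarith
    qed
    then show "AE x in lborel. x \<in> {0..T} \<longrightarrow> norm (q x) \<le> norm (A * (g x)\<^sup>2 + B)"
      by (intro AE_I2) (metis abs_ge_self order_trans real_norm_def)
  qed
qed

lemma testD:
  assumes "test z"
  shows "square_int T z" "prim z T = 0" "set_integrable lborel {0..T} z" "continuous_on {0..T} (prim z)"
    "continuous_on {0..T-1} (Bop (prim z))"
  using assms by (auto simp: test_def intro: square_int_imp_integrable prim_cont continuous_on_Bop)

lemma test_add:
  assumes "test z" "test w"
  shows "test (\<lambda>x. z x + t * w x)"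
    and "x \<in> {0..T-1} \<Longrightarrow> Bop (prim (\<lambda>x. z x + t * w x)) x = Bop (prim z) x + t * Bop (prim w) x"
    and "first_variation (\<lambda>x. z x + t * w x) = first_variation z + t * first_variation w"
proof -
  note z = testD[OF assms(1)] and w = testD[OF assms(2)]
  have pr: "prim (\<lambda>x. z x + t * w x) y = prim z y + t * prim w y" if "y \<in> {0..T}" for y
    by (rule prim_add[OF z(3) w(3) that])
  show "test (\<lambda>x. z x + t * w x)"
    using z w T pr[of T] square_int_add[OF z(1) w(1)] by (simp add: test_def)
  show "Bop (prim (\<lambda>x. z x + t * w x)) x = Bop (prim z) x + t * Bop (prim w) x" if x: "x \<in> {0..T-1}"
  proof -
    have "Bop (prim (\<lambda>x. z x + t * w x)) x = Bop (\<lambda>y. prim z y + t * prim w y) x"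
      unfolding Bop_def using x by (intro set_lebesgue_integral_cong) (auto intro!: pr)
    then show ?thesis using Bop_add[OF z(4) w(4) x] by simp
  qed
  have int: "set_integrable lborel {0..T} (\<lambda>x. p x * y x + q x * prim y x)" if "test y" for y
    by (intro set_integral_add(1) square_int_mult p_square_int set_integrable_mult_continuous q_integrable testD[OF that])
  have "first_variation (\<lambda>x. z x + t * w x)
      = (LBINT x:{0..T}. (p x * z x + q x * prim z x) + t * (p x * w x + q x * prim w x))"
    unfolding first_variation_def by (intro set_lebesgue_integral_cong) (auto simp: pr algebra_simps)
  also have "\<dots> = first_variation z + t * first_variation w"
    unfolding first_variation_def using int[OF assms(1)] int[OF assms(2)]
    by (subst set_integral_add(2)) auto
  finally show "first_variation (\<lambda>x. z x + t * w x) = first_variation z + t * first_variation w" .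
qed

lemma test_quadratic: "test (\<lambda>x. T - 2 * x)"
proof -
  have "\<bar>T - 2 * x\<bar> \<le> T" if "x \<in> {0..T}" for x using that by auto
  then have "square_int T (\<lambda>x. T - 2 * x)" by (intro square_int_bounded[of _ _ T]) auto
  then show ?thesis using T by (simp add: test_def prim_quadratic power2_eq_square)
qed

lemma contact_subset: "contact_set T u \<subseteq> {0..T-1}"
  by (auto simp: contact_set_def)

lemma contact_closed: "closed (contact_set T u)"
proof -
  have "contact_set T u = {0..T-1} \<inter> Bop u -` {0}" by (auto simp: contact_set_def)
  then show ?thesis
    by (simp add: continuous_closed_preimage continuous_on_Bop u_cont)
qed

lemma variation_nonneg:
  assumes z: "test z" and nn: "\<And>x. x \<in> contact_set T u \<Longrightarrow> 0 \<le> Bop (prim z) x"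
  shows "0 \<le> first_variation z"
proof (rule field_le_epsilon)
  fix e :: real assume e: "0 < e"
  let ?w = "\<lambda>x. T - 2 * x"
  define c where "c = \<bar>first_variation ?w\<bar> + 1"
  \<comment> \<open>The added quadratic direction then contributes at most \<open>e\<close>; the 1
    in \<open>c\<close> avoids a zero denominator.\<close>
  define t where "t = e / c"
  have c: "0 < c" by (simp add: c_def)
  then have t: "0 < t" using e by (simp add: t_def)
  have "0 \<le> first_variation (\<lambda>x. z x + t * ?w x)"
  proof (rule variation_strict[OF test_add(1)[OF z test_quadratic]])
    fix x assume x: "x \<in> contact_set T u"
    then have x': "x \<in> {0..T-1}" using contact_subset by auto
    have "0 < t * Bop (prim ?w) x" using Bop_prim_quadratic[OF T x'] t by simp
    then show "0 < Bop (prim (\<lambda>x. z x + t * ?w x)) x"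
      unfolding test_add(2)[OF z test_quadratic x'] using nn[OF x] by simp
  qed
  also have "\<dots> = first_variation z + t * first_variation ?w"
    by (rule test_add(3)[OF z test_quadratic])
  also have "t * first_variation ?w \<le> t * c" using t by (intro mult_left_mono) (auto simp: c_def)
  also have "t * c = e" using c by (simp add: t_def)
  finally show "0 \<le> first_variation z + e" by simp
qed

lemma multiplier:
  obtains \<Phi> where "mono \<Phi>" "\<And>s. s < 0 \<Longrightarrow> \<Phi> s = 0"
    "\<And>s t. s \<le> t \<Longrightarrow> contact_set T u \<inter> {s<..t} = {} \<Longrightarrow> \<Phi> s = \<Phi> t"
    "\<And>z. test z \<Longrightarrow> first_variation z = (LBINT t:{0..T}. (\<Phi> t - \<Phi> (t - 1)) * prim z t)"
proof -
  define S where "S = contact_set T u"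
  have S: "S \<subseteq> {0..T-1}" using contact_subset by (simp add: S_def)
  \<comment> \<open>Values are prescribed only on \<open>S\<close>, so the functional really acts on
    functions on \<open>S\<close>. That \<open>r\<close> does not depend on the choice of
    \<open>z\<close> is contained in positivity, supplied by
    \<open>variation_nonneg\<close>.\<close>
  define V where "V = {(\<phi>, r). \<exists>z. test z \<and> (\<forall>x\<in>S. \<phi> x = Bop (prim z) x) \<and> r = first_variation z}"
  have zero: "test (\<lambda>x. 0)"
    using square_int_bounded[of "\<lambda>x. 0" T 0] by (simp add: test_def prim_def)
  have Vmem: "(\<phi>, r) \<in> V" if "test z" "\<And>x. x \<in> S \<Longrightarrow> \<phi> x = Bop (prim z) x" "r = first_variation z" for \<phi> r z
    using that by (auto simp: V_def)
  have comb: "((\<lambda>x. \<phi> x + t * \<psi> x), r + t * s) \<in> V" if "(\<phi>, r) \<in> V" "(\<psi>, s) \<in> V" for \<phi> r \<psi> s t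
  proof -
    obtain z w where zw: "test z" "\<forall>x\<in>S. \<phi> x = Bop (prim z) x" "r = first_variation z"
      "test w" "\<forall>x\<in>S. \<psi> x = Bop (prim w) x" "s = first_variation w"
      using \<open>(\<phi>, r) \<in> V\<close> \<open>(\<psi>, s) \<in> V\<close> unfolding V_def by blast
    show ?thesis
      by (rule Vmem[OF test_add(1)[OF zw(1,4), of t]])
        (use zw S test_add(2,3)[OF zw(1,4), where t=t] in auto)
  qed
  have z0: "((\<lambda>x. 0), 0) \<in> V"
    by (rule Vmem[OF zero]) (auto simp: prim_def Bop_def first_variation_def)
  have pgV: "pos_graph S V"
    unfolding pos_graph_def
  proof (intro conjI allI impI)
    fix \<phi> r \<psi> s t
    assume *: "(\<phi>, r) \<in> V"
    show "((\<lambda>x. t * \<phi> x), t * r) \<in> V" using comb[OF z0 *, of t] by simp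
    show "0 \<le> r" if "\<forall>x\<in>S. 0 \<le> \<phi> x"
      using * that variation_nonneg by (auto simp: V_def S_def)
    assume "(\<psi>, s) \<in> V"
    with * show "((\<lambda>x. \<phi> x + \<psi> x), r + s) \<in> V" using comb[of \<phi> r \<psi> s 1] by simp
  qed
  let ?w = "\<lambda>x. T - 2 * x"
  have "(Bop (prim ?w), first_variation ?w) \<in> V" by (rule Vmem[OF test_quadratic]) auto
  \<comment> \<open>The factor 6 normalizes the lower bound 1/6 to the 1 demanded by the extension
    lemma.\<close>
  from pos_graph_scale[OF pgV this, of 6]
  have e: "((\<lambda>x. 6 * Bop (prim ?w) x), 6 * first_variation ?w) \<in> V" .
  have e1: "1 \<le> 6 * Bop (prim ?w) x" if "x \<in> S" for x
    using Bop_prim_quadratic[OF T, of x] S that by auto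
  obtain L where L: "positive_functional S L"
    and LV: "\<And>\<phi> r. (\<phi>, r) \<in> V \<Longrightarrow> bounded (\<phi> ` S) \<Longrightarrow> L \<phi> = r"
    by (rule positive_functional_extension[OF pgV e e1]) auto
  interpret positive_functional S L by (rule L)
  have N: "0 \<le> T - 1" using T by simp
  show thesis
  proof (rule that[of \<Phi>])
    show "mono \<Phi>" by (rule mono_\<Phi>)
    show neg: "\<Phi> s = 0" if "s < 0" for s by (rule \<Phi>_neg) (use S that in auto)
    have const: "\<Phi> s = \<Phi> (T - 1)" if "T - 1 \<le> s" for s by (rule \<Phi>_eq) (use S that in auto)
    show "\<Phi> s = \<Phi> t" if "s \<le> t" "contact_set T u \<inter> {s<..t} = {}" for s t
      by (rule \<Phi>_eq) (use that in \<open>force simp: S_def\<close>)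
    fix z assume z: "test z"
    note zD = testD[OF z]
    have "bounded (Bop (prim z) ` S)"
      by (rule bounded_subset[OF compact_imp_bounded[OF compact_continuous_image[OF zD(5) compact_Icc]]]) (use S in auto)
    then have "first_variation z = L (Bop (prim z))"
      using LV[OF Vmem[OF z refl refl]] by simp
    also have "\<dots> = Bop (prim z) (T - 1) * \<Phi> (T - 1) - (LBINT s:{0..T-1}. (prim z (s + 1) - prim z s) * \<Phi> s)"
    proof (rule stieltjes_representation(2)[OF S N Bop_has_real_derivative[OF zD(4)]])
      show "continuous_on {0..T-1} (\<lambda>x. prim z (x + 1) - prim z x)"
        by (intro continuous_intros continuous_on_compose2[OF zD(4)]) auto
    qed
    also have "\<dots> = (LBINT t:{0..T-1+1}. (\<Phi> t - \<Phi> (t - 1)) * prim z t)"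
      by (rule Bop_adjoint[OF N mono_\<Phi> neg const]) (use zD(4) in auto)
    finally show "first_variation z = (LBINT t:{0..T}. (\<Phi> t - \<Phi> (t - 1)) * prim z t)" by simp
  qed
qed

text \<open>The test function has derivative \<open>z = p - R - c\<close>, with \<open>R\<close> the
  primitive of \<open>q - h\<close> and \<open>c\<close> the mean of \<open>p - R\<close>. The
  equation and integration by parts make \<open>z\<close> orthogonal to \<open>p - R\<close>, its
  zero mean makes it orthogonal to constants, and so the integral of \<open>z\<^sup>2\<close>
  vanishes.\<close>

lemma du_bois_reymond:
  assumes h: "set_integrable lborel {0..T} h"
    and fv: "\<And>z. test z \<Longrightarrow> first_variation z = (LBINT t:{0..T}. h t * prim z t)"
  obtains c where "AE x in lborel. x \<in> {0..T} \<longrightarrow> p x = c + prim (\<lambda>x. q x - h x) x"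
proof -
  define r where "r x = q x - h x" for x
  have r: "set_integrable lborel {0..T} r"
    unfolding r_def by (intro set_integral_diff(1) q_integrable h)
  define R where "R x = indicator {0..T} x * prim r x" for x
  have R_eq: "R x = prim r x" if "x \<in> {0..T}" for x using that by (simp add: R_def)
  have R_sq: "square_int T R"
  proof -
    obtain B where B: "\<And>x. x \<in> {0..T} \<Longrightarrow> \<bar>prim r x\<bar> \<le> B"
      by (rule continuous_on_Icc_bounded[OF continuous_on_prim[OF r]]) blast
    have "R \<in> borel_measurable borel"
      using borel_measurable_continuous_on_indicator[OF _ continuous_on_prim[OF r]] by (simp add: R_def[abs_def])
    then show ?thesis by (rule square_int_bounded[of _ _ B]) (simp add: R_eq B)
  qed
  define c where "c = prim (\<lambda>x. p x + (-1) * R x) T / T"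
  have pR: "square_int T (\<lambda>x. p x + (-1) * R x)" by (rule square_int_add[OF p_square_int R_sq])
  have one: "square_int T (\<lambda>x. 1)" by (rule square_int_bounded[of _ _ 1]) auto
  define z where "z x = (p x + (-1) * R x) + (- c) * 1" for x
  have z_sq: "square_int T z" unfolding z_def by (rule square_int_add[OF pR one])
  have "prim (\<lambda>x. 1) T = T" using T by (simp add: prim_def set_lebesgue_integral_def)
  then have "prim z T = 0"
    unfolding z_def using T
    by (subst prim_add[OF square_int_imp_integrable[OF pR] square_int_imp_integrable[OF one]]) (auto simp: c_def)
  with z_sq have z: "test z" by (simp add: test_def)
  note zD = testD[OF z]
  have ints: "set_integrable lborel {0..T} (\<lambda>x. p x * z x)" "set_integrable lborel {0..T} (\<lambda>x. q x * prim z x)"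
    "set_integrable lborel {0..T} (\<lambda>x. h x * prim z x)" "set_integrable lborel {0..T} (\<lambda>x. R x * z x)"
    by (intro square_int_mult p_square_int zD R_sq set_integrable_mult_continuous q_integrable h)+
  have "0 = (LBINT x:{0..T}. p x * z x + q x * prim z x) - (LBINT x:{0..T}. h x * prim z x)"
    using fv[OF z] by (simp add: first_variation_def)
  also have "\<dots> = (LBINT x:{0..T}. p x * z x) + ((LBINT x:{0..T}. q x * prim z x) - (LBINT x:{0..T}. h x * prim z x))"
    using ints by (subst set_integral_add(2)) auto
  also have "(LBINT x:{0..T}. q x * prim z x) - (LBINT x:{0..T}. h x * prim z x) = (LBINT x:{0..T}. r x * prim z x)"
    using ints by (subst set_integral_diff(2)[symmetric]) (auto simp: r_def algebra_simps)
  also have "\<dots> = - (LBINT x:{0..T}. prim r x * z x)"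
    using prim_integration_by_parts[OF _ r zD(3)] T zD(2) by simp
  also have "(LBINT x:{0..T}. prim r x * z x) = (LBINT x:{0..T}. R x * z x)"
    by (intro set_lebesgue_integral_cong) (auto simp: R_eq)
  finally have "(LBINT x:{0..T}. p x * z x - R x * z x) = 0"
    using ints by (subst set_integral_diff(2)) auto
  moreover have "(LBINT x:{0..T}. (z x)\<^sup>2) = (LBINT x:{0..T}. (p x * z x - R x * z x) - c * z x)"
    by (intro set_lebesgue_integral_cong) (auto simp: z_def power2_eq_square algebra_simps)
  moreover have "\<dots> = (LBINT x:{0..T}. p x * z x - R x * z x) - c * prim z T"
    unfolding prim_def using ints zD(3)
    by (subst set_integral_diff(2)) (auto intro!: set_integral_diff(1))
  ultimately have "(LBINT x:{0..T}. (z x)\<^sup>2) = 0" using zD(2) by simp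
  then have "(\<integral>x. indicator {0..T} x *\<^sub>R (z x)\<^sup>2 \<partial>lborel) = 0" by (simp add: set_lebesgue_integral_def)
  moreover have "integrable lborel (\<lambda>x. indicator {0..T} x *\<^sub>R (z x)\<^sup>2)"
    using z_sq by (simp add: square_int_def set_integrable_def)
  ultimately have "AE x in lborel. indicator {0..T} x *\<^sub>R (z x)\<^sup>2 = 0"
    by (subst (asm) integral_nonneg_eq_0_iff_AE) auto
  then have "AE x in lborel. x \<in> {0..T} \<longrightarrow> p x = c + prim (\<lambda>x. q x - h x) x"
    by eventually_elim (auto simp: z_def R_eq r_def[abs_def])
  then show thesis by (rule that)
qed

end

section \<open>Regularity\<close>

lemma prim_lipschitz:
  assumes r: "set_integrable lborel {0..T} r" and B: "\<And>x. x \<in> {0..T} \<Longrightarrow> \<bar>r x\<bar> \<le> B" and B0: "0 \<le> B"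
  shows "B-lipschitz_on {0..T} (prim r)"
proof (rule lipschitz_onI[OF _ B0])
  have half: "\<bar>prim r y - prim r x\<bar> \<le> B * (y - x)" if xy: "0 \<le> x" "x \<le> y" "y \<le> T" for x y
  proof -
    have r_int: "r integrable_on {s..t}" if "0 \<le> s" "t \<le> T" for s t
      by (rule integrable_on_subinterval[OF set_borel_integral_eq_integral(1)[OF r]]) (use that in auto)
    have "integral {0..x} r + integral {x..y} r = integral {0..y} r"
      using xy by (intro Henstock_Kurzweil_Integration.integral_combine r_int) auto
    then have "prim r y - prim r x = integral {x..y} r"
      using xy prim_eq_integral[OF r, of x] prim_eq_integral[OF r, of y] by simp
    moreover have "norm (integral {x..y} r) \<le> B * (y - x)"
      using has_integral_bound_real[OF B0 finite.emptyI integrable_integral[OF r_int[of x y]]] xy B by simp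
    ultimately show ?thesis by simp
  qed
  fix x y assume "x \<in> {0..T}" "y \<in> {0..T}"
  then show "dist (prim r x) (prim r y) \<le> B * dist x y"
    using half[of x y] half[of y x] by (cases "x \<le> y") (auto simp: dist_real_def abs_minus_commute)
qed

lemma prim_has_real_derivative:
  assumes r: "set_integrable lborel {0..T} r" and x: "x \<in> {0<..<T}" and cont: "isCont r x"
  shows "(prim r has_real_derivative r x) (at x)"
proof -
  have "((\<lambda>y. integral {0..y} r) has_vector_derivative r x) (at x within ({0..T} - {}))"
    using x cont by (intro integral_has_vector_derivative_continuous_at set_borel_integral_eq_integral(1)[OF r])
      (auto intro: continuous_at_imp_continuous_at_within)
  then have "((\<lambda>y. integral {0..y} r) has_real_derivative r x) (at x within {0..T})"
    by (simp add: has_real_derivative_iff_has_vector_derivative)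
  then have "(prim r has_real_derivative r x) (at x within {0..T})"
    by (rule has_field_derivative_transform_within[OF _ zero_less_one]) (use x prim_eq_integral[OF r] in auto)
  moreover have "at x within {0..T} = at x" using x by (intro at_within_interior) auto
  ultimately show ?thesis by simp
qed

lemma lipschitz_on_divide:
  fixes f d :: "real \<Rightarrow> real"
  assumes f: "C-lipschitz_on S f" and d: "D-lipschitz_on S d"
    and B: "\<And>x. x \<in> S \<Longrightarrow> \<bar>f x\<bar> \<le> B" "0 \<le> B" and m: "\<And>x. x \<in> S \<Longrightarrow> m \<le> d x" "0 < m"
  shows "(C / m + B * D / m\<^sup>2)-lipschitz_on S (\<lambda>x. f x / d x)"
proof (rule lipschitz_onI)
  have C0: "0 \<le> C" and D0: "0 \<le> D" using f d lipschitz_on_nonneg by auto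
  then show "0 \<le> C / m + B * D / m\<^sup>2" using B m by simp
  fix x y assume xy: "x \<in> S" "y \<in> S"
  have dx: "m \<le> d x" "0 < d x" and dy: "m \<le> d y" "0 < d y" using m(1)[OF xy(1)] m(1)[OF xy(2)] m(2) by auto
  have "f x / d x - f y / d y = (f x - f y) / d x + f y * (d y - d x) / (d x * d y)"
    using dx dy by (simp add: field_simps)
  also have "\<bar>\<dots>\<bar> \<le> \<bar>f x - f y\<bar> / d x + (\<bar>f y\<bar> * \<bar>d y - d x\<bar>) / (d x * d y)"
    using dx dy by (intro order_trans[OF abs_triangle_ineq]) (simp add: abs_mult abs_divide)
  also have "\<dots> \<le> (C * \<bar>x - y\<bar>) / m + (B * (D * \<bar>x - y\<bar>)) / (m * m)"
    using lipschitz_onD[OF f xy] lipschitz_onD[OF d xy(2,1)] dx dy B C0 D0 xy m(2)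
    by (intro add_mono frac_le mult_mono) (auto simp: dist_real_def abs_minus_commute)
  also have "\<dots> = (C / m + B * D / m\<^sup>2) * dist x y"
    by (simp add: dist_real_def power2_eq_square algebra_simps)
  finally show "dist (f x / d x) (f y / d y) \<le> (C / m + B * D / m\<^sup>2) * dist x y"
    by (simp add: dist_real_def)
qed

lemma prim_cong_AE:
  assumes "r \<in> borel_measurable borel" "s \<in> borel_measurable borel"
    and "AE x in lborel. x \<in> {0..T} \<longrightarrow> r x = s x" and "x \<in> {0..T}"
  shows "prim r x = prim s x"
proof -
  note [measurable] = assms(1,2)
  show ?thesis unfolding prim_def set_lebesgue_integral_def
    by (rule integral_cong_AE; (measurable)?)
      (use assms(3) in eventually_elim, use assms(4) in \<open>auto simp: indicator_def\<close>)
qed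

context obstacle_minimizer
begin

lemma q_meas: "q \<in> borel_measurable borel"
  unfolding q_def by measurable

text \<open>\<open>g1\<close> is the continuous representative of u'. \<open>g2\<close> is defined
  by solving the equation for u'', so the equation holds at every interior point by construction;
  the content is that \<open>g2\<close> is the weak derivative of \<open>g1\<close>.\<close>

lemma regularity:
  assumes a0: "a0 > 0" and a_ge: "\<forall>s. a s \<ge> a0"
  obtains g1 g2 \<Phi> where "weak_deriv_on T u g1" "weak_deriv_on T g1 g2"
    "ess_bdd_on T u" "ess_bdd_on T g1" "ess_bdd_on T g2" "mono \<Phi>"
    "\<And>s t. s \<le> t \<Longrightarrow> contact_set T u \<inter> {s<..t} = {} \<Longrightarrow> \<Phi> s = \<Phi> t"
    "\<And>x. x \<in> {0<..<T} \<Longrightarrow> - 2 * a (u x) * g2 x - deriv a (u x) * (g1 x)\<^sup>2 + deriv b (u x) = \<Phi> x - \<Phi> (x - 1)"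
proof -
  obtain \<Phi> where mono: "mono \<Phi>" and neg: "\<And>s. s < 0 \<Longrightarrow> \<Phi> s = 0"
    and const: "\<And>s t. s \<le> t \<Longrightarrow> contact_set T u \<inter> {s<..t} = {} \<Longrightarrow> \<Phi> s = \<Phi> t"
    and fv: "\<And>z. test z \<Longrightarrow> first_variation z = (LBINT t:{0..T}. (\<Phi> t - \<Phi> (t - 1)) * prim z t)"
    by (rule multiplier) blast
  define h where "h t = \<Phi> t - \<Phi> (t - 1)" for t
  have [measurable]: "\<Phi> \<in> borel_measurable borel" by (rule borel_measurable_mono[OF mono])
  have h_meas [measurable]: "h \<in> borel_measurable borel" unfolding h_def by measurable
  \<comment> \<open>\<open>\<Phi>\<close> is nondecreasing and zero on negative arguments, so both
    of its values lie between 0 and \<open>\<Phi> T\<close>; the point -2 lies below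
    \<open>t - 1\<close>.\<close>
  have h_bd: "\<bar>h t\<bar> \<le> \<Phi> T" if "t \<in> {0..T}" for t
    using monoD[OF mono, of "t - 1" t] monoD[OF mono, of t T] monoD[OF mono, of "-2" "t - 1"] neg[of "-2"] that
    by (auto simp: h_def)
  have h_int: "set_integrable lborel {0..T} h"
    by (rule set_integrable_bounded[OF _ h_bd]) (auto simp: set_borel_measurable_def)
  obtain c where c: "AE x in lborel. x \<in> {0..T} \<longrightarrow> p x = c + prim (\<lambda>x. q x - h x) x"
    by (rule du_bois_reymond[OF h_int]) (auto simp: fv h_def)
  define r where "r = (\<lambda>x. q x - h x)"
  note q_meas [measurable]
  have r_meas [measurable]: "r \<in> borel_measurable borel" unfolding r_def by measurable
  have r_int: "set_integrable lborel {0..T} r"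
    unfolding r_def by (intro set_integral_diff(1) q_integrable h_int)
  have a_pos: "0 < a s" for s using a0 a_ge[rule_format, of s] by linarith
  \<comment> \<open>Continuous representative of \<open>p\<close>, extended to the line by
    clamping.\<close>
  define P where "P x = c + prim r (max 0 (min T x))" for x
  define g1 where "g1 x = P x / (2 * a (ub x))" for x
  have P_cont: "continuous_on UNIV P" unfolding P_def
    by (intro continuous_intros continuous_on_compose2[OF continuous_on_prim[OF r_int]]) (use T in auto)
  have g1_cont: "continuous_on UNIV g1" unfolding g1_def
    by (intro continuous_intros P_cont ub_compose(1) coefficients_continuous) (use a_pos in \<open>simp add: less_imp_neq[symmetric]\<close>)
  have g1_meas [measurable]: "g1 \<in> borel_measurable borel" by (rule borel_measurable_continuous_onI[OF g1_cont])
  have g_g1: "AE x in lborel. x \<in> {0..T} \<longrightarrow> g x = g1 x"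
    using c
  proof eventually_elim
    case (elim x)
    show ?case
    proof
      assume x: "x \<in> {0..T}"
      then have "p x = P x" using elim by (simp add: P_def r_def)
      then show "g x = g1 x" using a_pos[of "ub x"] by (simp add: p_def g1_def field_simps)
    qed
  qed
  obtain G where G: "\<And>x. x \<in> {0..T} \<Longrightarrow> \<bar>g1 x\<bar> \<le> G"
    using continuous_on_Icc_bounded[OF continuous_on_subset[OF g1_cont subset_UNIV]] by blast
  have G0: "0 \<le> G" using G[of 0] T by force
  have g1_int: "set_integrable lborel {0..T} g1"
    by (rule set_integrable_bounded[OF _ G]) (auto simp: set_borel_measurable_def)
  have wd1: "weak_deriv_on T u g1"
    unfolding weak_deriv_on_prim
    using prim_cong_AE[OF g_meas g1_meas g_g1] weak_derivD(3)[OF minimizer_props(1)] g1_int g1_meas by metis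
  \<comment> \<open>Replacing \<open>g\<close> by \<open>g1\<close> changes \<open>q\<close> only on
    a null set but makes it continuous, hence bounded on \<open>{0..T}\<close>; this upgrades
    \<open>P\<close> there from continuous to Lipschitz.\<close>
  define q1 where "q1 x = deriv a (ub x) * (g1 x)\<^sup>2 + deriv b (ub x)" for x
  define r1 where "r1 x = q1 x - h x" for x
  have q1_cont: "continuous_on UNIV q1" unfolding q1_def
    by (intro continuous_intros g1_cont ub_compose(1) coefficients_continuous)
  have [measurable]: "q1 \<in> borel_measurable borel" by (rule borel_measurable_continuous_onI[OF q1_cont])
  have r1_meas [measurable]: "r1 \<in> borel_measurable borel" unfolding r1_def by measurable
  obtain Q where Q: "\<And>x. x \<in> {0..T} \<Longrightarrow> \<bar>q1 x\<bar> \<le> Q"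
    using continuous_on_Icc_bounded[OF continuous_on_subset[OF q1_cont subset_UNIV]] by blast
  define R where "R = Q + \<Phi> T"
  have R: "\<bar>r1 x\<bar> \<le> R" if "x \<in> {0..T}" for x
    using Q[OF that] h_bd[OF that] by (simp add: r1_def R_def)
  have R0: "0 \<le> R" using R[of 0] T by force
  have r1_int: "set_integrable lborel {0..T} r1"
    by (rule set_integrable_bounded[OF _ R]) (auto simp: set_borel_measurable_def)
  have "AE x in lborel. x \<in> {0..T} \<longrightarrow> r x = r1 x"
    using g_g1 by eventually_elim (auto simp: r_def r1_def q_def q1_def)
  then have P_eq: "P x = c + prim r1 x" if "x \<in> {0..T}" for x
    using prim_cong_AE[OF r_meas r1_meas _ that] that by (simp add: P_def)
  have u_eq: "u x = 1 + prim g1 x" if "x \<in> {0..T}" for x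
    using weak_derivD(3)[OF wd1 that] minimizer_props(3) by simp
  define d where "d x = 2 * a (u x)" for x
  have g1_eq: "g1 x = (c + prim r1 x) / d x" if "x \<in> {0..T}" for x
    using that by (simp add: g1_def P_eq d_def ub_eq)
  have u_lip: "G-lipschitz_on {0..T} u"
    using lipschitz_onD[OF prim_lipschitz[OF g1_int G G0]] u_eq G0 by (intro lipschitz_onI) (auto simp: dist_real_def)
  have d_lip: "(2 * (La * G))-lipschitz_on {0..T} d"
  proof (rule lipschitz_onI)
    have La0: "0 \<le> La" using a_lip lipschitz_on_nonneg by blast
    then show "0 \<le> 2 * (La * G)" using G0 by simp
    fix x y assume xy: "x \<in> {0..T}" "y \<in> {0..T}"
    have "dist (a (u x)) (a (u y)) \<le> La * dist (u x) (u y)" by (rule lipschitz_onD[OF a_lip]) auto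
    also have "\<dots> \<le> La * (G * dist x y)" by (intro mult_left_mono La0 lipschitz_onD[OF u_lip] xy)
    finally have "dist (a (u x)) (a (u y)) \<le> La * (G * dist x y)" .
    moreover have "dist (d x) (d y) = 2 * dist (a (u x)) (a (u y))" by (simp add: d_def dist_real_def abs_if)
    ultimately show "dist (d x) (d y) \<le> 2 * (La * G) * dist x y" by (simp add: algebra_simps)
  qed
  have P_lip: "R-lipschitz_on {0..T} (\<lambda>x. c + prim r1 x)"
    using lipschitz_onD[OF prim_lipschitz[OF r1_int R R0]] R0 by (intro lipschitz_onI) (auto simp: dist_real_def)
  obtain B where B: "\<And>x. x \<in> {0..T} \<Longrightarrow> \<bar>c + prim r1 x\<bar> \<le> B"
  proof -
    obtain B where "\<And>x. x \<in> {0..T} \<Longrightarrow> \<bar>P x\<bar> \<le> B"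
      using continuous_on_Icc_bounded[OF continuous_on_subset[OF P_cont subset_UNIV]] by blast
    with that show thesis by (metis P_eq)
  qed
  have B0: "0 \<le> B" using B[of 0] T by force
  have d_ge: "2 * a0 \<le> d x" for x using a_ge by (simp add: d_def)
  have quot_lip: "(R / (2 * a0) + B * (2 * (La * G)) / (2 * a0)\<^sup>2)-lipschitz_on {0..T} (\<lambda>x. (c + prim r1 x) / d x)"
    by (rule lipschitz_on_divide[OF P_lip d_lip B B0 d_ge]) (use a0 in auto)
  define C where "C = R / (2 * a0) + B * (2 * (La * G)) / (2 * a0)\<^sup>2"
  have g1_lip: "C-lipschitz_on {0..T} g1"
    by (rule lipschitz_on_transform[OF quot_lip[folded C_def]]) (simp add: g1_eq)
  \<comment> \<open>Quotient rule for \<open>P / (2 * a (u))\<close>, with \<open>P\<close> in the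
    result rewritten as \<open>2 * a (u) * g1\<close>.\<close>
  define g2 where "g2 x = (r1 x - 2 * deriv a (ub x) * (g1 x)\<^sup>2) / (2 * a (ub x))" for x
  have g2_meas: "g2 \<in> borel_measurable borel" unfolding g2_def by measurable
  have der: "(g1 has_real_derivative g2 x) (at x)"
    if x: "x \<in> {0<..<T}" and cont: "isCont \<Phi> x" "isCont \<Phi> (x - 1)" for x
  proof -
    have x': "x \<in> {0..T}" using x by auto
    have "isCont (\<lambda>y. \<Phi> (y - 1)) x"
      by (rule isCont_o2[where f="\<lambda>y. y - 1" and g=\<Phi>, OF _ cont(2)]) (intro continuous_intros)
    then have "isCont h x" unfolding h_def[abs_def] using cont(1) by (intro continuous_intros)
    moreover have "isCont q1 x" using q1_cont by (simp add: continuous_on_eq_continuous_at)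
    ultimately have "isCont r1 x" unfolding r1_def[abs_def] by (intro continuous_intros)
    then have d1: "(prim r1 has_real_derivative r1 x) (at x)"
      by (rule prim_has_real_derivative[OF r1_int x])
    have "isCont g1 x" using g1_cont by (simp add: continuous_on_eq_continuous_at)
    then have d2: "(prim g1 has_real_derivative g1 x) (at x)"
      by (rule prim_has_real_derivative[OF g1_int x])
    \<comment> \<open>Writing \<open>u\<close> as \<open>1 + prim g1\<close> expresses
      \<open>g1\<close> through primitives that are differentiable at \<open>x\<close>;
      \<open>F\<close> and \<open>g1\<close> agree near the interior point \<open>x\<close>.\<close>
    define F where "F y = (c + prim r1 y) / (2 * a (1 + prim g1 y))" for y
    have F_eq: "F y = g1 y" if "y \<in> {0..T}" for y
      using that by (simp add: F_def g1_eq d_def u_eq)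
    have Px: "c + prim r1 x = g1 x * (2 * a (u x))"
      using g1_eq[OF x'] a_pos[of "u x"] by (simp add: d_def)
    have ux: "u x = 1 + prim g1 x" by (rule u_eq[OF x'])
    have "(F has_real_derivative (r1 x * (2 * a (1 + prim g1 x)) - (c + prim r1 x) * (2 * (deriv a (1 + prim g1 x) * g1 x)))
        / ((2 * a (1 + prim g1 x)) * (2 * a (1 + prim g1 x)))) (at x)"
      unfolding F_def using a_pos[of "1 + prim g1 x"]
      by (auto intro!: derivative_eq_intros d1 d2 DERIV_chain2[OF C1_UNIV_derivD(1)[OF a_C1]])
    also have "(r1 x * (2 * a (1 + prim g1 x)) - (c + prim r1 x) * (2 * (deriv a (1 + prim g1 x) * g1 x)))
        / ((2 * a (1 + prim g1 x)) * (2 * a (1 + prim g1 x))) = g2 x"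
      unfolding Px ux[symmetric] g2_def ub_eq[OF x'] using a_pos[of "u x"]
      by (simp add: field_simps power2_eq_square)
    finally show ?thesis
      by (rule has_field_derivative_transform_within_open[of _ _ _ "{0<..<T}"]) (use x F_eq in auto)
  qed
  have AEd: "AE x in lborel. x \<in> {0<..<T} \<longrightarrow> (g1 has_real_derivative g2 x) (at x)"
    using AE_isCont_mono[OF mono, of 0] AE_isCont_mono[OF mono, of 1]
    by eventually_elim (use der in auto)
  \<comment> \<open>Being Lipschitz, \<open>g1\<close> is recovered on every \<open>{0..y}\<close>
    from its almost-everywhere derivative, which is what the weak derivative demands.\<close>
  have ftc: "set_integrable lborel {0..y} g2" "prim g2 y = g1 y - g1 0" if y: "y \<in> {0..T}" for y
  proof -
    have AEy: "AE x in lborel. x \<in> {0<..<y} \<longrightarrow> (g1 has_real_derivative g2 x) (at x)"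
      using AEd by eventually_elim (use y in auto)
    have "0 \<le> y" "C-lipschitz_on {0..y} g1" using y by (auto intro: lipschitz_on_subset[OF g1_lip])
    from lipschitz_fundamental_theorem[OF this AEy g2_meas]
    show "set_integrable lborel {0..y} g2" "prim g2 y = g1 y - g1 0" by (auto simp: prim_def)
  qed
  have wd2: "weak_deriv_on T g1 g2"
    unfolding weak_deriv_on_prim using g2_meas ftc T by auto
  have eq: "- 2 * a (u x) * g2 x - deriv a (u x) * (g1 x)\<^sup>2 + deriv b (u x) = \<Phi> x - \<Phi> (x - 1)"
    if "x \<in> {0<..<T}" for x
  proof -
    have "ub x = u x" using that by (intro ub_eq) auto
    then have "2 * a (u x) * g2 x = r1 x - 2 * deriv a (u x) * (g1 x)\<^sup>2"
      using a_pos[of "u x"] by (simp add: g2_def)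
    then show ?thesis using \<open>ub x = u x\<close> by (simp add: r1_def q1_def h_def)
  qed
  obtain U where U: "\<And>x. \<bar>ub x\<bar> \<le> U" using ub_bounded by blast
  obtain A where A: "\<And>x. \<bar>deriv a (ub x)\<bar> \<le> A" using ub_compose(2)[OF coefficients_continuous(2)] by blast
  have g2_bd: "\<bar>g2 x\<bar> \<le> (R + 2 * A * G\<^sup>2) / (2 * a0)" if "x \<in> {0..T}" for x
  proof -
    have "\<bar>2 * deriv a (ub x) * (g1 x)\<^sup>2\<bar> \<le> 2 * A * G\<^sup>2"
      using A[of x] power_mono[OF G[OF that], of 2] unfolding abs_mult
      by (intro mult_mono) auto
    then have num: "\<bar>r1 x - 2 * deriv a (ub x) * (g1 x)\<^sup>2\<bar> \<le> R + 2 * A * G\<^sup>2" using R[OF that] by linarith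
    have "\<bar>g2 x\<bar> = \<bar>r1 x - 2 * deriv a (ub x) * (g1 x)\<^sup>2\<bar> / (2 * a (ub x))"
      using a_pos[of "ub x"] by (simp add: g2_def abs_divide)
    also have "\<dots> \<le> (R + 2 * A * G\<^sup>2) / (2 * a0)"
      using num a0 a_ge by (intro frac_le) auto
    finally show ?thesis .
  qed
  have ess: "ess_bdd_on T w" if "\<And>x. x \<in> {0..T} \<Longrightarrow> \<bar>w x\<bar> \<le> M" for w M
    unfolding ess_bdd_on_def using that by (intro exI[of _ M] AE_I2) auto
  have "\<bar>u x\<bar> \<le> U" if "x \<in> {0..T}" for x using U[of x] ub_eq[OF that] by simp
  from that[OF wd1 wd2 ess[OF this] ess[OF G] ess[OF g2_bd] mono const eq]
  show thesis by blast
qed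

end

text \<open>Two successive weak derivatives, with \<open>u\<close> and both of them essentially
  bounded, express membership in W^{2,infinity}. A nonnegative Radon measure on the compact interval
  is a finite Borel measure, and its extension by zero is encoded as a measure on the line that is
  null off \<open>{0..T-1}\<close>.\<close>

theorem mainTheorem4:
  fixes T a0 :: real and a b u :: "real \<Rightarrow> real"
  assumes T: "T > 1"
    and a_C1: "a C1_differentiable_on UNIV" and b_C1: "b C1_differentiable_on UNIV"
    and a_lip: "\<exists>L. L-lipschitz_on UNIV a" and b_lip: "\<exists>L. L-lipschitz_on UNIV b"
    and a0: "a0 > 0" and a_ge: "\<forall>s. a s \<ge> a0"
    and uK: "u \<in> Kset T"
    and umin: "\<forall>w\<in>Kset T. Ffun a b T u \<le> Ffun a b T w"
  shows "\<exists>g g2 f.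
     weak_deriv_on T u g \<and> weak_deriv_on T g g2 \<and>
     ess_bdd_on T u \<and> ess_bdd_on T g \<and> ess_bdd_on T g2 \<and>
     sets f = sets borel \<and> finite_measure f \<and> emeasure f (- {0..T-1}) = 0 \<and>
     msupp f \<subseteq> contact_set T u \<and>
     (AE x in lborel. x \<in> {0<..<T} \<longrightarrow>
        - 2 * a (u x) * g2 x - deriv a (u x) * (g x)\<^sup>2 + deriv b (u x) = measure f {x-1..x})"
proof -
  obtain La Lb where L: "La-lipschitz_on UNIV a" "Lb-lipschitz_on UNIV b" using a_lip b_lip by blast
  interpret obstacle_minimizer T La Lb a b u
    by unfold_locales (use T a_C1 b_C1 L uK umin in auto)
  obtain g1 g2 \<Phi> where wd: "weak_deriv_on T u g1" "weak_deriv_on T g1 g2"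
    and bd: "ess_bdd_on T u" "ess_bdd_on T g1" "ess_bdd_on T g2" and mono: "mono \<Phi>"
    and const: "\<And>s t. s \<le> t \<Longrightarrow> contact_set T u \<inter> {s<..t} = {} \<Longrightarrow> \<Phi> s = \<Phi> t"
    and eq: "\<And>x. x \<in> {0<..<T} \<Longrightarrow> - 2 * a (u x) * g2 x - deriv a (u x) * (g1 x)\<^sup>2 + deriv b (u x) = \<Phi> x - \<Phi> (x - 1)"
    by (rule regularity[OF a0 a_ge]) blast
  obtain f where f: "sets f = sets borel" "finite_measure f" "emeasure f (- contact_set T u) = 0"
      "msupp f \<subseteq> contact_set T u"
    and f_eq: "AE x in lborel. measure f {x-1..x} = \<Phi> x - \<Phi> (x - 1)"
    by (rule stieltjes_measure[OF mono contact_closed contact_subset const]) auto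
  have "emeasure f (- {0..T-1}) \<le> emeasure f (- contact_set T u)"
    using contact_subset contact_closed f(1) by (intro emeasure_mono) auto
  then have "emeasure f (- {0..T-1}) = 0" using f(3) by simp
  moreover have "AE x in lborel. x \<in> {0<..<T} \<longrightarrow>
      - 2 * a (u x) * g2 x - deriv a (u x) * (g1 x)\<^sup>2 + deriv b (u x) = measure f {x-1..x}"
    using f_eq by eventually_elim (use eq in auto)
  ultimately show ?thesis using wd bd f(1,2,4) by blast
qed

end
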